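(* For positive integers $m,n$, the fan graph $F_{m,n}$ is Schur positive if and only if \[ (m,n)\in\{(1,n)\colon n\in\{1,2,3,4\}\}\cup\{(2,n)\colon n\in\{1,\dots,6\}\}\cup\{(3,4)\}. \]
   Context: The fan graph $F_{m,n}$ is the join $\overline{K_m}+P_n$ of the edgeless graph on $m$ vertices and the path $P_n$ on $n$ vertices (every vertex of $\overline{K_m}$ is adjacent to every vertex of $P_n$). For a finite simple graph $G$, the chromatic symmetric function is $X_G=\sum_{\kappa}\prod_{v\in V(G)}x_{\kappa(v)}$ over proper colorings $\kappa:V(G)\to\{1,2,\dots\}$; $G$ is Schur positive if all coefficients of $X_G$ in the Schur basis are nonnegative. *)

theory Defs
  imports Main
begin

text \<open>Graphs are given by a finite vertex set V and a symmetric irreflexive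
edge relation E. Colours are natural numbers; the variable x_k of the
chromatic symmetric function is indexed by k :: nat (a relabelling of
x_1, x_2, ...). A monomial x^alpha is given by an exponent function
alpha :: nat => nat.\<close>

text \<open>Coefficient of the monomial x^alpha in X_G: number of proper colourings
(extensional outside V) with colour class sizes alpha.\<close>
definition chrom_coeff :: "'v set \<Rightarrow> ('v \<Rightarrow> 'v \<Rightarrow> bool) \<Rightarrow> (nat \<Rightarrow> nat) \<Rightarrow> nat" where
  "chrom_coeff V E alpha = card {\<kappa> :: 'v \<Rightarrow> nat.
      (\<forall>v. v \<notin> V \<longrightarrow> \<kappa> v = 0) \<and>
      (\<forall>u\<in>V. \<forall>v\<in>V. E u v \<longrightarrow> \<kappa> u \<noteq> \<kappa> v) \<and>
      (\<forall>k. card {v\<in>V. \<kappa> v = k} = alpha k)}"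

definition is_partition :: "nat list \<Rightarrow> nat \<Rightarrow> bool" where
  "is_partition lam d \<longleftrightarrow> sorted (rev lam) \<and> 0 \<notin> set lam \<and> sum_list lam = d"

definition young_cells :: "nat list \<Rightarrow> (nat \<times> nat) set" where
  "young_cells lam = {(i, j). i < length lam \<and> j < lam ! i}"

text \<open>Kostka number K_{lam,alpha}: number of semistandard Young tableaux of
shape lam and content alpha = coefficient of x^alpha in the Schur function s_lam.\<close>
definition kostka :: "nat list \<Rightarrow> (nat \<Rightarrow> nat) \<Rightarrow> nat" where
  "kostka lam alpha = card {T :: nat \<times> nat \<Rightarrow> nat.
      (\<forall>c. c \<notin> young_cells lam \<longrightarrow> T c = 0) \<and>
      (\<forall>i j. (i, j) \<in> young_cells lam \<longrightarrow> (i, Suc j) \<in> young_cells lam \<longrightarrow> T (i, j) \<le> T (i, Suc j)) \<and>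
      (\<forall>i j. (i, j) \<in> young_cells lam \<longrightarrow> (Suc i, j) \<in> young_cells lam \<longrightarrow> T (i, j) < T (Suc i, j)) \<and>
      (\<forall>k. card {c \<in> young_cells lam. T c = k} = alpha k)}"

text \<open>Schur positivity: X_G = sum of c_lam s_lam over partitions lam of |V|
with all c_lam \<ge> 0 (compared coefficientwise on all monomials).\<close>
definition schur_positive :: "'v set \<Rightarrow> ('v \<Rightarrow> 'v \<Rightarrow> bool) \<Rightarrow> bool" where
  "schur_positive V E \<longleftrightarrow> (\<exists>c :: nat list \<Rightarrow> int. (\<forall>lam. c lam \<ge> 0) \<and>
      (\<forall>alpha. int (chrom_coeff V E alpha) =
         (\<Sum>lam\<in>{lam. is_partition lam (card V)}. c lam * int (kostka lam alpha))))"

definition fan_V :: "nat \<Rightarrow> nat \<Rightarrow> (nat + nat) set" where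
  "fan_V m n = Inl ` {..<m} \<union> Inr ` {..<n}"

fun fan_E :: "nat + nat \<Rightarrow> nat + nat \<Rightarrow> bool" where
  "fan_E (Inl _) (Inr _) = True"
| "fan_E (Inr _) (Inl _) = True"
| "fan_E (Inr i) (Inr j) = (i + 1 = j \<or> j + 1 = i)"
| "fan_E (Inl _) (Inl _) = False"

end

theory Submission
  imports Defs
begin

text \<open>
The proof rests on two properties of the Kostka numbers \<open>K\<^sub>\<lambda>\<^sub>,\<^sub>\<alpha>\<close>.

First, if \<open>\<alpha>\<^sub>i > \<alpha>\<^sub>i\<^sub>+\<^sub>1\<close> and \<open>K\<^sub>\<lambda>\<^sub>,\<^sub>\<alpha> > 0\<close>, then some entry \<open>i\<close> of a tableau may be raised to \<open>i + 1\<close>.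
Hence in a Schur positive graph every vector of colour class sizes that occurs may be balanced by
moving one unit from a larger to a smaller neighbouring class. For a fan the colours of \<open>K\<^sub>m\<close> (edgeless)
and of the path are disjoint, and a path coloured with two colours has class sizes \<open>\<lceil>n/2\<rceil>\<close> and \<open>\<lfloor>n/2\<rfloor>\<close>.
So with at most four colours either some class has size \<open>m\<close> or two classes have sizes \<open>\<lceil>n/2\<rceil>\<close> and \<open>\<lfloor>n/2\<rfloor>\<close>,
and balancing a suitable colouring violates this. Three colours leave only \<open>\<bar>n - 2m\<bar> \<le> 2\<close>, and four
colours exclude all of these with \<open>m \<ge> 3\<close> except \<open>(3,4)\<close>, \<open>(3,6)\<close>, \<open>(3,8)\<close> and \<open>(4,6)\<close>.

Secondly, \<open>K\<^sub>\<lambda>\<^sub>,\<^sub>\<alpha>\<close> and the coefficients of the chromatic symmetric function are computed by peeling off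
the largest colour: a horizontal strip on one side, one block of a stable partition on the other.
This settles the finitely many remaining graphs: Schur expansions for the positive ones, and for
the three others a functional that is nonnegative on all Schur functions but negative on the graph.
\<close>

section \<open>Formal linear combinations\<close>

text \<open>Merging equal keys keeps the lists short when the removal of strips and blocks is
  iterated, where many terms coincide.\<close>

fun add_term :: "'a \<Rightarrow> int \<Rightarrow> ('a \<times> int) list \<Rightarrow> ('a \<times> int) list" where
  "add_term x c [] = [(x, c)]"
| "add_term x c ((y, d) # F) = (if x = y then (y, c + d) # F else (y, d) # add_term x c F)"

definition lin_ext :: "('a \<Rightarrow> 'b list) \<Rightarrow> ('a \<times> int) list \<Rightarrow> ('b \<times> int) list" where
  "lin_ext f F = foldr (\<lambda>(x, c) G. foldr (\<lambda>y. add_term y c) (f x) G) F []"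

definition lin_eval :: "('a \<Rightarrow> int) \<Rightarrow> ('a \<times> int) list \<Rightarrow> int" where
  "lin_eval g F = (\<Sum>(x, c)\<leftarrow>F. c * g x)"

lemma lin_eval_add_term: "lin_eval g (add_term x c F) = c * g x + lin_eval g F"
  by (induction x c F rule: add_term.induct) (auto simp: lin_eval_def algebra_simps)

text \<open>Duality: a recursion for a functional, such as stripping the largest entry off a
  tableau, becomes an operation on formal combinations that can be computed.\<close>

lemma lin_eval_lin_ext: "lin_eval g (lin_ext f F) = lin_eval (\<lambda>x. \<Sum>y\<leftarrow>f x. g y) F"
proof -
  have *: "lin_eval g (foldr (\<lambda>y. add_term y c) ys G) = c * (\<Sum>y\<leftarrow>ys. g y) + lin_eval g G"
    for c ys G
    by (induction ys) (auto simp: lin_eval_add_term algebra_simps)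
  show ?thesis
    unfolding lin_ext_def
    by (induction F) (auto simp: *, auto simp: lin_eval_def)
qed

lemma lin_eval_cong: "(\<And>x c. (x, c) \<in> set F \<Longrightarrow> g x = h x) \<Longrightarrow> lin_eval g F = lin_eval h F"
  unfolding lin_eval_def by (intro arg_cong[where f = sum_list] map_cong) auto

lemma sum_sum_list: "(\<Sum>k\<in>K. \<Sum>x\<leftarrow>xs. f k x) = (\<Sum>x\<leftarrow>xs. \<Sum>k\<in>K. f k x)"
  for f :: "'a \<Rightarrow> 'b \<Rightarrow> 'c :: comm_monoid_add"
  by (induction xs) (simp_all add: sum.distrib)

lemma sum_list_concat_map: "sum_list (concat (map f xs)) = (\<Sum>x\<leftarrow>xs. sum_list (f x))"
  by (induction xs) simp_all

lemma int_sum_list: "int (\<Sum>x\<leftarrow>xs. f x) = (\<Sum>x\<leftarrow>xs. int (f x))"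
  by (induction xs) simp_all

section \<open>Kostka numbers\<close>

text \<open>Serves tableaux (\<open>V\<close> the cells) and colourings (\<open>V\<close> the
  vertices) alike. In both cases it shows that \<alpha> has finite support, which the definitions do
  not demand.\<close>

lemma fibre_support:
  assumes "finite V" "\<forall>k. card {v \<in> V. f v = k} = \<alpha> k"
  shows "{k. \<alpha> k \<noteq> 0} = f ` V"
proof -
  have "\<alpha> k \<noteq> 0 \<longleftrightarrow> k \<in> f ` V" for k
  proof -
    have "\<alpha> k \<noteq> 0 \<longleftrightarrow> {v \<in> V. f v = k} \<noteq> {}"
      using assms(1) by (simp flip: assms(2)[rule_format])
    then show ?thesis by auto
  qed
  then show ?thesis by auto
qed

lemma fibre_sum:
  assumes "finite V" "\<forall>k. card {v \<in> V. f v = k} = \<alpha> k"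
  shows "(\<Sum>k | \<alpha> k \<noteq> 0. \<alpha> k) = card V"
proof -
  have "(\<Sum>k | \<alpha> k \<noteq> 0. \<alpha> k) = (\<Sum>k\<in>f ` V. card {v \<in> V. f v = k})"
    unfolding fibre_support[OF assms] using assms(2) by simp
  also have "\<dots> = card V"
    using sum.image_gen[OF assms(1), of "\<lambda>_. 1::nat" f] by (simp only: card_eq_sum)
  finally show ?thesis .
qed

definition ssyt :: "nat list \<Rightarrow> (nat \<Rightarrow> nat) \<Rightarrow> (nat \<times> nat \<Rightarrow> nat) set" where
  "ssyt lam \<alpha> = {T.
      (\<forall>c. c \<notin> young_cells lam \<longrightarrow> T c = 0) \<and>
      (\<forall>i j. (i, j) \<in> young_cells lam \<longrightarrow> (i, Suc j) \<in> young_cells lam \<longrightarrow> T (i, j) \<le> T (i, Suc j)) \<and>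
      (\<forall>i j. (i, j) \<in> young_cells lam \<longrightarrow> (Suc i, j) \<in> young_cells lam \<longrightarrow> T (i, j) < T (Suc i, j)) \<and>
      (\<forall>k. card {c \<in> young_cells lam. T c = k} = \<alpha> k)}"

lemma kostka_ssyt: "kostka lam \<alpha> = card (ssyt lam \<alpha>)"
  unfolding kostka_def ssyt_def ..

lemma young_cells_Sigma: "young_cells lam = (SIGMA i:{..<length lam}. {..<lam ! i})"
  unfolding young_cells_def by auto

lemma finite_young_cells [simp]: "finite (young_cells lam)"
  unfolding young_cells_Sigma by simp

lemma card_young_cells: "card (young_cells lam) = sum_list lam"
  unfolding young_cells_Sigma
  by (simp add: sum_list_sum_nth lessThan_atLeast0)

lemma mem_young_cells [simp]: "(i, j) \<in> young_cells lam \<longleftrightarrow> i < length lam \<and> j < lam ! i"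
  unfolding young_cells_def by simp

lemma ssyt_support: "T \<in> ssyt lam \<alpha> \<Longrightarrow> {k. \<alpha> k \<noteq> 0} = T ` young_cells lam"
  by (rule fibre_support) (auto simp: ssyt_def)

lemma ssyt_sum: "T \<in> ssyt lam \<alpha> \<Longrightarrow> (\<Sum>k | \<alpha> k \<noteq> 0. \<alpha> k) = sum_list lam"
  using fibre_sum[of "young_cells lam" T \<alpha>] by (auto simp: ssyt_def card_young_cells)

text \<open>Nothing is assumed about \<alpha>: either there is no tableau, or a single one shows
  that \<alpha> has finite support, and then all entries come from a finite set.\<close>

lemma finite_ssyt [simp]: "finite (ssyt lam \<alpha>)"
proof (cases "ssyt lam \<alpha> = {}")
  case False
  then obtain T0 where "T0 \<in> ssyt lam \<alpha>" by blast
  from ssyt_support[OF this] have "finite {k. \<alpha> k \<noteq> 0}" by simp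
  note fin = finite_set_of_finite_funs[OF finite_young_cells[of lam] this, of 0]
  show ?thesis
  proof (rule finite_subset[OF _ fin], rule subsetI)
    fix T assume T: "T \<in> ssyt lam \<alpha>"
    then have "\<forall>c. c \<notin> young_cells lam \<longrightarrow> T c = 0" by (simp add: ssyt_def)
    with ssyt_support[OF T]
    show "T \<in> {T. \<forall>c. (c \<in> young_cells lam \<longrightarrow> T c \<in> {k. \<alpha> k \<noteq> 0}) \<and>
        (c \<notin> young_cells lam \<longrightarrow> T c = 0)}" by blast
  qed
qed simp

lemma ssyt_row_mono:
  assumes "T \<in> ssyt lam \<alpha>" "j \<le> j'" "i < length lam" "j' < lam ! i"
  shows "T (i, j) \<le> T (i, j')"
  using assms(2,4)
proof (induction j' rule: dec_induct)
  case (step j')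
  have "T (i, j') \<le> T (i, Suc j')"
    using assms(1,3) step by (simp add: ssyt_def)
  with step show ?case by simp
qed simp

lemma kostka_nonzeroD:
  assumes "kostka lam \<alpha> \<noteq> 0"
  shows "finite {k. \<alpha> k \<noteq> 0}" "(\<Sum>k | \<alpha> k \<noteq> 0. \<alpha> k) = sum_list lam"
proof -
  have "ssyt lam \<alpha> \<noteq> {}"
    using assms unfolding kostka_ssyt by force
  then obtain T where T: "T \<in> ssyt lam \<alpha>" by blast
  show "finite {k. \<alpha> k \<noteq> 0}" "(\<Sum>k | \<alpha> k \<noteq> 0. \<alpha> k) = sum_list lam"
    using ssyt_support[OF T] ssyt_sum[OF T] by simp_all
qed

text \<open>Stripping leaves rows of length 0 in place, so the empty shape appears as a list of
  zeros and is recognised by its sum.\<close>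

lemma kostka_zero: "kostka lam (\<lambda>_. 0) = (if sum_list lam = 0 then 1 else 0)"
proof (cases "sum_list lam = 0")
  case True
  then have "card (young_cells lam) = 0" by (simp only: card_young_cells)
  then have e: "young_cells lam = {}" by (simp only: card_0_eq[OF finite_young_cells])
  have "T \<in> ssyt lam (\<lambda>_. 0) \<longleftrightarrow> T = (\<lambda>_. 0)" for T
    unfolding ssyt_def e by (simp add: fun_eq_iff)
  then have "ssyt lam (\<lambda>_. 0) = {\<lambda>_. 0}" by blast
  with True show ?thesis by (simp only: kostka_ssyt card.empty card.insert) simp
next
  case False
  have "kostka lam (\<lambda>_. 0) = 0"
  proof (rule ccontr)
    assume "kostka lam (\<lambda>_. 0) \<noteq> 0"
    from kostka_nonzeroD(2)[OF this] False show False by simp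
  qed
  with False show ?thesis by simp
qed

text \<open>The shapes left after removing a horizontal strip of \<open>a\<close> cells. The subtraction is truncated,
so that rows may be given in any order.\<close>
fun strips :: "nat \<Rightarrow> nat list \<Rightarrow> nat list list" where
  "strips a [] = (if a = 0 then [[]] else [])"
| "strips a (x # xs) = concat (map (\<lambda>b. map ((#) (x - b)) (strips (a - b) xs))
     [0..<min (Suc a) (Suc (x - (case xs of [] \<Rightarrow> 0 | y # _ \<Rightarrow> y)))])"

lemma set_strips_Cons:
  "\<nu> \<in> set (strips a (x # xs)) \<longleftrightarrow> (\<exists>b \<nu>'. \<nu> = (x - b) # \<nu>' \<and> b \<le> a \<and>
     b \<le> x - (case xs of [] \<Rightarrow> 0 | y # _ \<Rightarrow> y) \<and> \<nu>' \<in> set (strips (a - b) xs))"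
proof -
  define r where "r = [0..<min (Suc a) (Suc (x - (case xs of [] \<Rightarrow> 0 | y # _ \<Rightarrow> y)))]"
  have "b \<in> set r \<longleftrightarrow> b \<le> a \<and> b \<le> x - (case xs of [] \<Rightarrow> 0 | y # _ \<Rightarrow> y)" for b
    by (auto simp: r_def simp del: upt_Suc)
  moreover have "\<nu> \<in> set (strips a (x # xs)) \<longleftrightarrow>
      (\<exists>b\<in>set r. \<exists>\<nu>'\<in>set (strips (a - b) xs). \<nu> = (x - b) # \<nu>')"
    unfolding strips.simps r_def[symmetric] by auto
  ultimately show ?thesis by (simp add: Bex_def) metis
qed

text \<open>For a partition the minimum is \<open>lam ! Suc i\<close>, and the condition is the
  interlacing that characterises horizontal strips. For rows in any order the minimum still
  expresses that no removed cell has a cell of \<open>lam\<close> directly below it.\<close>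

lemma set_strips:
  "\<nu> \<in> set (strips a lam) \<longleftrightarrow> length \<nu> = length lam \<and>
     (\<forall>i<length lam. \<nu> ! i \<le> lam ! i \<and>
        (Suc i < length lam \<longrightarrow> min (lam ! i) (lam ! Suc i) \<le> \<nu> ! i)) \<and>
     sum_list \<nu> + a = sum_list lam" (is "_ \<longleftrightarrow> ?P \<nu> a lam")
proof (induction lam arbitrary: a \<nu>)
  case (Cons x xs)
  define h where "h = (case xs of [] \<Rightarrow> 0 | y # _ \<Rightarrow> y)"
  show ?case (is "?l = ?r")
  proof
    assume ?l
    then obtain b \<nu>' where b: "b \<le> a" "b \<le> x - h" "\<nu> = (x - b) # \<nu>'"
        "\<nu>' \<in> set (strips (a - b) xs)"
      unfolding set_strips_Cons h_def[symmetric] by metis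
    note P = b(4)[unfolded Cons.IH]
    have h: "0 < length xs \<Longrightarrow> xs ! 0 = h" by (auto simp: h_def split: list.splits)
    show ?r
    proof (intro conjI allI impI)
      fix i assume i: "i < length (x # xs)"
      show "\<nu> ! i \<le> (x # xs) ! i" using b(3) P i by (cases i) auto
      assume i: "Suc i < length (x # xs)"
      show "min ((x # xs) ! i) ((x # xs) ! Suc i) \<le> \<nu> ! i"
        using b(2,3) P i h by (cases i) auto
    next
      have "b \<le> x" using b(2) by simp
      moreover have "sum_list \<nu>' + (a - b) = sum_list xs" using P by blast
      ultimately show "sum_list \<nu> + a = sum_list (x # xs)" using b(1) unfolding b(3) by simp
    qed (use b(3) P in simp)
  next
    assume r: ?r
    then obtain y \<nu>' where y: "\<nu> = y # \<nu>'" by (cases \<nu>) auto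
    have le: "y \<le> x" using r y by auto
    have h: "min x h \<le> y" using r y by (cases xs) (auto simp: h_def)
    have P: "length \<nu>' = length xs" "\<forall>i<length xs. \<nu>' ! i \<le> xs ! i \<and>
        (Suc i < length xs \<longrightarrow> min (xs ! i) (xs ! Suc i) \<le> \<nu>' ! i)"
      using r y by force+
    have "sum_list \<nu>' \<le> sum_list xs"
      unfolding sum_list_sum_nth P(1) using P by (intro sum_mono) auto
    moreover have "y + sum_list \<nu>' + a = x + sum_list xs" using r y by simp
    ultimately have "x - y \<le> a" "?P \<nu>' (a - (x - y)) xs" using le P by auto
    moreover have "y = x - (x - y)" "x - y \<le> x - h" using le h by auto
    ultimately show ?l unfolding y set_strips_Cons Cons.IH h_def[symmetric] by blast
  qed
qed auto

lemma distinct_concat_map: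
  assumes "distinct xs" "\<And>x. x \<in> set xs \<Longrightarrow> distinct (f x)"
    "\<And>x y. x \<in> set xs \<Longrightarrow> y \<in> set xs \<Longrightarrow> x \<noteq> y \<Longrightarrow> set (f x) \<inter> set (f y) = {}"
  shows "distinct (concat (map f xs))"
  using assms by (induction xs) fastforce+

text \<open>At most \<open>x\<close> cells leave a row of length \<open>x\<close>, so different
  numbers of removed cells leave different rows. The list can then be summed over as a set.\<close>

lemma distinct_strips: "distinct (strips a lam)"
proof (induction a lam rule: strips.induct)
  case (2 a x xs)
  show ?case
    unfolding strips.simps
    by (rule distinct_concat_map) (use 2 in \<open>auto simp: distinct_map simp del: upt_Suc\<close>)
qed auto

text \<open>Branching rule: the entries equal to \<open>N\<close>, the largest possible value, form
  a horizontal strip, and deleting them is a bijection onto the tableaux of the smaller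
  shapes.\<close>

lemma kostka_strips:
  assumes "\<forall>k>N. \<alpha> k = 0"
  shows "kostka lam \<alpha> = (\<Sum>\<nu>\<leftarrow>strips (\<alpha> N) lam. kostka \<nu> (\<alpha>(N := 0)))"
proof -
  let ?\<beta> = "\<alpha>(N := 0)"
  define sh where "sh T = map (\<lambda>i. card {j. j < lam ! i \<and> T (i, j) < N}) [0..<length lam]" for T :: "nat \<times> nat \<Rightarrow> nat"
  define F where "F T = (sh T, \<lambda>c. if c \<in> young_cells lam \<and> T c < N then T c else 0)" for T
  define G where "G = (\<lambda>(\<nu>, T) c. if c \<in> young_cells \<nu> then T c else if c \<in> young_cells lam then N else 0 :: nat)"
  let ?S = "SIGMA \<nu>:set (strips (\<alpha> N) lam). ssyt \<nu> ?\<beta>"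
  \<comment> \<open>Rows increase weakly, so the entries below \<open>N\<close> fill an initial
    segment of each row, and their number determines which cells they occupy.\<close>
  have cells: "c \<in> young_cells (sh T) \<longleftrightarrow> c \<in> young_cells lam \<and> T c < N" if T: "T \<in> ssyt lam \<alpha>" for T c
  proof -
    obtain i j where c: "c = (i, j)" by force
    show ?thesis
    proof (cases "i < length lam")
      case True
      define A where "A = {j. j < lam ! i \<and> T (i, j) < N}"
      have down: "j' \<in> A" if "j \<in> A" "j' \<le> j" for j j'
        using that ssyt_row_mono[OF T that(2) True] by (auto simp: A_def)
      have "finite A" by (simp add: A_def)
      have "A = {..<card A}"
      proof (cases "A = {}")
        case False
        define x where "x = Max A"
        have "A = {..x}"
        proof
          show "A \<subseteq> {..x}" using Max_ge[OF \<open>finite A\<close>] by (auto simp: x_def)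
          show "{..x} \<subseteq> A"
            using down[OF Max_in[OF \<open>finite A\<close> False]] by (auto simp: x_def)
        qed
        then show ?thesis by (simp add: lessThan_Suc_atMost)
      qed simp
      then have "j < card A \<longleftrightarrow> j \<in> A" by auto
      with True show ?thesis unfolding c by (auto simp: sh_def A_def)
    qed (auto simp: c sh_def)
  qed
  have less: "T c < N \<longleftrightarrow> T c \<noteq> N" if T: "T \<in> ssyt lam \<alpha>" "c \<in> young_cells lam" for T c
  proof -
    have "\<alpha> (T c) \<noteq> 0" using ssyt_support[OF T(1)] T(2) by blast
    then show ?thesis using assms by (metis nat_neq_iff)
  qed
  have F: "F T \<in> ?S" "G (F T) = T" if T: "T \<in> ssyt lam \<alpha>" for T
  proof -
    note cells = cells[OF T] and less = less[OF T]
    have len: "length (sh T) = length lam" by (simp add: sh_def)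
    have sub: "young_cells (sh T) \<subseteq> young_cells lam" using cells by auto
    have "card (young_cells lam) = card (young_cells (sh T)) + card {c \<in> young_cells lam. T c = N}"
      by (subst card_Un_disjoint[symmetric]) (auto simp: cells less intro!: arg_cong[where f = card])
    then have sum: "sum_list (sh T) + \<alpha> N = sum_list lam"
      using T by (simp add: card_young_cells ssyt_def)
    have row: "sh T ! i \<le> lam ! i" if "i < length lam" for i
      using that card_mono[of "{..<lam ! i}" "{j. j < lam ! i \<and> T (i, j) < N}"] by (auto simp: sh_def)
    \<comment> \<open>Otherwise the first removed cell of row \<open>i\<close> has a cell of
      \<open>lam\<close> below it, whose entry column strictness would force to exceed
      \<open>N\<close>.\<close>
    have col: "min (lam ! i) (lam ! Suc i) \<le> sh T ! i" if i: "Suc i < length lam" for i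
    proof (rule ccontr)
      assume "\<not> ?thesis"
      then have *: "(i, sh T ! i) \<in> young_cells lam" "(Suc i, sh T ! i) \<in> young_cells lam"
        "(i, sh T ! i) \<notin> young_cells (sh T)" using i by auto
      then have "T (i, sh T ! i) < T (Suc i, sh T ! i)" using T by (simp add: ssyt_def)
      moreover have "T (Suc i, sh T ! i) \<le> N" using less[OF *(2)] by linarith
      ultimately show False using * cells by auto
    qed
    have nu: "sh T \<in> set (strips (\<alpha> N) lam)"
      unfolding set_strips using len row col sum by blast
    have eq: "snd (F T) c = T c" if "c \<in> young_cells (sh T)" for c
      using that unfolding F_def cells by simp
    have "snd (F T) \<in> ssyt (sh T) ?\<beta>"
      unfolding ssyt_def
    proof (intro CollectI conjI allI impI)
      fix c assume "c \<notin> young_cells (sh T)"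
      then show "snd (F T) c = 0" unfolding cells F_def by auto
    next
      fix i j assume *: "(i, j) \<in> young_cells (sh T)" "(i, Suc j) \<in> young_cells (sh T)"
      with sub T show "snd (F T) (i, j) \<le> snd (F T) (i, Suc j)"
        unfolding eq[OF *(1)] eq[OF *(2)] ssyt_def by blast
    next
      fix i j assume *: "(i, j) \<in> young_cells (sh T)" "(Suc i, j) \<in> young_cells (sh T)"
      with sub T show "snd (F T) (i, j) < snd (F T) (Suc i, j)"
        unfolding eq[OF *(1)] eq[OF *(2)] ssyt_def by blast
    next
      fix k
      have "{c \<in> young_cells (sh T). snd (F T) c = k} = (if k = N then {} else {c \<in> young_cells lam. T c = k})"
        using eq cells less by auto
      then show "card {c \<in> young_cells (sh T). snd (F T) c = k} = ?\<beta> k"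
        using T by (simp add: ssyt_def)
    qed
    with nu show "F T \<in> ?S" by (simp add: F_def)
    show "G (F T) = T"
    proof
      fix c
      have "T c = 0" if "c \<notin> young_cells lam" using T that unfolding ssyt_def by blast
      moreover have "T c = N" if "c \<in> young_cells lam" "c \<notin> young_cells (sh T)"
        using that cells less by blast
      ultimately show "G (F T) c = T c"
        unfolding G_def F_def using cells by auto
    qed
  qed
  have G: "G (\<nu>, T) \<in> ssyt lam \<alpha>" "F (G (\<nu>, T)) = (\<nu>, T)"
    if \<nu>: "\<nu> \<in> set (strips (\<alpha> N) lam)" and T: "T \<in> ssyt \<nu> ?\<beta>" for \<nu> T
  proof -
    note s = \<nu>[unfolded set_strips]
    have len: "length \<nu> = length lam" using s by blast
    have le: "\<nu> ! i \<le> lam ! i" if "i < length lam" for i using s that by blast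
    have sub: "young_cells \<nu> \<subseteq> young_cells lam"
      unfolding young_cells_Sigma len using le by fastforce
    have lt: "T c < N" if "c \<in> young_cells \<nu>" for c
    proof -
      have "?\<beta> (T c) \<noteq> 0" using ssyt_support[OF T] that by blast
      then show ?thesis using assms by (metis fun_upd_apply nat_neq_iff)
    qed
    have in\<nu>: "G (\<nu>, T) c = T c" if "c \<in> young_cells \<nu>" for c using that by (simp add: G_def)
    have out: "G (\<nu>, T) c = N" if "c \<in> young_cells lam" "c \<notin> young_cells \<nu>" for c
      using that by (simp add: G_def)
    have le_N: "G (\<nu>, T) c \<le> N" if "c \<in> young_cells lam" for c
      using that lt[of c] by (auto simp: G_def)
    show "G (\<nu>, T) \<in> ssyt lam \<alpha>"
      unfolding ssyt_def
    proof (intro CollectI conjI allI impI)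
      fix c assume "c \<notin> young_cells lam"
      with sub show "G (\<nu>, T) c = 0" by (auto simp: G_def)
    next
      fix i j assume c: "(i, j) \<in> young_cells lam" "(i, Suc j) \<in> young_cells lam"
      show "G (\<nu>, T) (i, j) \<le> G (\<nu>, T) (i, Suc j)"
      proof (cases "(i, Suc j) \<in> young_cells \<nu>")
        case True
        then have "(i, j) \<in> young_cells \<nu>" by simp
        with True T show ?thesis by (simp only: in\<nu>) (simp add: ssyt_def)
      next
        case False
        with out c le_N show ?thesis by simp
      qed
    next
      fix i j assume c: "(i, j) \<in> young_cells lam" "(Suc i, j) \<in> young_cells lam"
      then have i: "i < length lam" "Suc i < length lam" and j: "j < min (lam ! i) (lam ! Suc i)"
        by simp_all
      \<comment> \<open>A cell of \<open>lam\<close> with another one below it survives in \<nu>, so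
        of two vertically adjacent cells only the lower can carry the new entry
        \<open>N\<close>.\<close>
      with s have "j < \<nu> ! i" by (meson order_less_le_trans)
      with i len have *: "(i, j) \<in> young_cells \<nu>" by simp
      show "G (\<nu>, T) (i, j) < G (\<nu>, T) (Suc i, j)"
      proof (cases "(Suc i, j) \<in> young_cells \<nu>")
        case True
        with * T show ?thesis by (simp only: in\<nu>) (simp add: ssyt_def)
      next
        case False
        with out[OF c(2)] in\<nu>[OF *] lt[OF *] show ?thesis by simp
      qed
    next
      fix k
      have "card {c \<in> young_cells \<nu>. T c = k} = ?\<beta> k" using T by (simp add: ssyt_def)
      moreover have "{c \<in> young_cells lam. G (\<nu>, T) c = k} =
          (if k = N then young_cells lam - young_cells \<nu> else {c \<in> young_cells \<nu>. T c = k})"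
        using sub lt by (auto simp: G_def)
      moreover have "card (young_cells lam - young_cells \<nu>) = \<alpha> N"
      proof -
        have "sum_list \<nu> + \<alpha> N = sum_list lam" using s by blast
        then show ?thesis
          unfolding card_Diff_subset[OF finite_young_cells sub] card_young_cells by simp
      qed
      ultimately show "card {c \<in> young_cells lam. G (\<nu>, T) c = k} = \<alpha> k" by simp
    qed
    have "sh (G (\<nu>, T)) = \<nu>"
    proof (rule nth_equalityI)
      fix i assume "i < length (sh (G (\<nu>, T)))"
      then have i: "i < length lam" by (simp add: sh_def)
      have "j < lam ! i \<and> G (\<nu>, T) (i, j) < N \<longleftrightarrow> j < \<nu> ! i" for j
        using i len le[OF i] lt[of "(i, j)"] by (auto simp: G_def)
      then show "sh (G (\<nu>, T)) ! i = \<nu> ! i" using i by (simp add: sh_def)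
    qed (simp add: sh_def len)
    moreover have "T c = 0" if "c \<notin> young_cells \<nu>" for c
      using T that unfolding ssyt_def by blast
    then have "(if c \<in> young_cells lam \<and> G (\<nu>, T) c < N then G (\<nu>, T) c else 0) = T c" for c
      using sub lt[of c] by (auto simp: G_def)
    ultimately show "F (G (\<nu>, T)) = (\<nu>, T)" by (simp add: F_def)
  qed
  have "bij_betw F (ssyt lam \<alpha>) ?S"
  proof (rule bij_betw_byWitness[of _ G])
    show "\<forall>T\<in>ssyt lam \<alpha>. G (F T) = T" using F(2) by blast
    show "\<forall>p\<in>?S. F (G p) = p" using G(2) by fast
    show "F ` ssyt lam \<alpha> \<subseteq> ?S" using F(1) by (rule image_subsetI)
    show "G ` ?S \<subseteq> ssyt lam \<alpha>" using G(1) by fast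
  qed
  then have "card (ssyt lam \<alpha>) = card ?S" by (rule bij_betw_same_card)
  also have "\<dots> = (\<Sum>\<nu>\<in>set (strips (\<alpha> N) lam). kostka \<nu> ?\<beta>)"
    by (simp add: kostka_ssyt)
  finally show ?thesis
    by (simp only: kostka_ssyt sum_list_distinct_conv_sum_set[OF distinct_strips])
qed

text \<open>There is a row whose last entry \<open>i\<close> has no \<open>i + 1\<close> below it, and this entry can be raised: otherwise
every \<open>i\<close> has an \<open>i + 1\<close> below it, contradicting the assumption on the content.\<close>
lemma kostka_shift_adjacent:
  assumes "\<alpha> (Suc i) < \<alpha> i" "kostka lam \<alpha> \<noteq> 0"
  shows "kostka lam (\<alpha>(i := \<alpha> i - 1, Suc i := \<alpha> (Suc i) + 1)) \<noteq> 0"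
proof -
  let ?Y = "young_cells lam"
  have "ssyt lam \<alpha> \<noteq> {}"
    using assms(2) unfolding kostka_ssyt by force
  then obtain T where T: "T \<in> ssyt lam \<alpha>" by blast
  define A where "A = {c \<in> ?Y. T c = i}"
  define B where "B = {c \<in> ?Y. T c = Suc i}"
  have card: "card A = \<alpha> i" "card B = \<alpha> (Suc i)"
    using T by (simp_all add: ssyt_def A_def B_def)
  have fin: "finite A" "finite B" by (simp_all add: A_def B_def)
  have row: "T (a, b) \<le> T (a, Suc b)" if "(a, b) \<in> ?Y" "(a, Suc b) \<in> ?Y" for a b
    using T that unfolding ssyt_def by blast
  have col: "T (a, b) < T (Suc a, b)" if "(a, b) \<in> ?Y" "(Suc a, b) \<in> ?Y" for a b
    using T that unfolding ssyt_def by blast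
  have "\<exists>r j. (r, j) \<in> A \<and> (r, Suc j) \<notin> A \<and> (Suc r, j) \<notin> B"
  proof (rule ccontr)
    assume *: "\<not> ?thesis"
    \<comment> \<open>Induction from the right end of the run of \<open>i\<close> in row
      \<open>r\<close>: an \<open>i + 1\<close> below the next \<open>i\<close> leaves, between
      column strictness and row monotonicity, only \<open>i + 1\<close> below the current
      one.\<close>
    have "(Suc r, j) \<in> B" if "(r, j) \<in> A" for r j
      using that
    proof (induction "lam ! r - j" arbitrary: j rule: less_induct)
      case less
      show ?case
      proof (cases "(r, Suc j) \<in> A")
        case True
        moreover from True have "lam ! r - Suc j < lam ! r - j" by (auto simp: A_def)
        ultimately have B: "(Suc r, Suc j) \<in> B" using less.hyps by blast
        then have c: "(Suc r, j) \<in> ?Y" "(Suc r, Suc j) \<in> ?Y" by (simp_all add: B_def)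
        from row[OF this] have "T (Suc r, j) \<le> T (Suc r, Suc j)" .
        moreover have "T (r, j) < T (Suc r, j)"
          using less.prems c(1) by (intro col) (simp_all add: A_def)
        ultimately show ?thesis using B c less.prems by (simp add: A_def B_def)
      next
        case False
        with * less.prems show ?thesis by blast
      qed
    qed
    then have "(\<lambda>(r, j). (Suc r, j)) ` A \<subseteq> B" by fast
    then have "card A \<le> card B"
      by (intro card_inj_on_le[OF _ _ fin(2)]) (auto simp: inj_on_def)
    with assms(1) card show False by simp
  qed
  then obtain r j where rj: "(r, j) \<in> A" "(r, Suc j) \<notin> A" "(Suc r, j) \<notin> B" by blast
  have in_Y: "(r, j) \<in> ?Y" and Ti: "T (r, j) = i" using rj(1) by (simp_all add: A_def)
  let ?T = "T((r, j) := Suc i)"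
  have "?T \<in> ssyt lam (\<alpha>(i := \<alpha> i - 1, Suc i := \<alpha> (Suc i) + 1))"
    unfolding ssyt_def
  proof (intro CollectI conjI allI impI)
    fix c assume "c \<notin> ?Y"
    then have "T c = 0" "c \<noteq> (r, j)" using T in_Y unfolding ssyt_def by blast+
    then show "?T c = 0" by simp
  next
    fix a b assume c: "(a, b) \<in> ?Y" "(a, Suc b) \<in> ?Y"
    have "Suc i \<le> T (a, Suc b)" if "(a, b) = (r, j)"
    proof -
      from that c(2) rj(2) have "T (a, Suc b) \<noteq> i" by (simp add: A_def)
      with that Ti row[OF c] show ?thesis by simp
    qed
    with row[OF c] Ti show "?T (a, b) \<le> ?T (a, Suc b)" by auto
  next
    fix a b assume c: "(a, b) \<in> ?Y" "(Suc a, b) \<in> ?Y"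
    have "Suc i < T (Suc a, b)" if "(a, b) = (r, j)"
    proof -
      from that c(2) rj(3) have "T (Suc a, b) \<noteq> Suc i" by (simp add: B_def)
      with that Ti col[OF c] show ?thesis by simp
    qed
    with col[OF c] Ti show "?T (a, b) < ?T (Suc a, b)" by auto
  next
    fix k
    have "{c \<in> ?Y. ?T c = k} = (if k = i then A - {(r, j)}
        else if k = Suc i then insert (r, j) B else {c \<in> ?Y. T c = k})"
      using in_Y Ti by (auto simp: A_def B_def)
    moreover have "card {c \<in> ?Y. T c = k} = \<alpha> k" using T by (simp add: ssyt_def)
    moreover have "(r, j) \<notin> B" using Ti by (simp add: B_def)
    ultimately show "card {c \<in> ?Y. ?T c = k} = (\<alpha>(i := \<alpha> i - 1, Suc i := \<alpha> (Suc i) + 1)) k"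
      using card fin rj(1) by simp
  qed
  then show ?thesis
    unfolding kostka_ssyt using card_0_eq[OF finite_ssyt] by blast
qed

section \<open>Stable partitions\<close>

text \<open>The number of ways of giving distinct colours to blocks of sizes \<open>L\<close> such that exactly \<open>\<alpha> k\<close> vertices
have colour \<open>k\<close>. The condition \<open>\<alpha> k \<noteq> 0\<close> keeps the sum finite for \<open>x = 0\<close>.\<close>
fun block_colourings :: "nat list \<Rightarrow> (nat \<Rightarrow> nat) \<Rightarrow> nat" where
  "block_colourings [] \<alpha> = of_bool (\<alpha> = (\<lambda>_. 0))"
| "block_colourings (x # L) \<alpha> = (\<Sum>k | \<alpha> k \<noteq> 0 \<and> \<alpha> k = x. block_colourings L (\<alpha>(k := 0)))"

text \<open>Results are repeated when \<open>a\<close> occurs several times: equal sizes belong to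
  different blocks, and each of these may be the one removed.\<close>

fun removals :: "'a \<Rightarrow> 'a list \<Rightarrow> 'a list list" where
  "removals a [] = []"
| "removals a (x # xs) = (if x = a then [xs] else []) @ map ((#) x) (removals a xs)"

text \<open>Exactly one block receives the colour \<open>N\<close>, and it has size
  \<open>\<alpha> N\<close>; the sum runs over the choice of this block. For
  \<open>\<alpha> N = 0\<close> there would be no such block.\<close>

lemma block_colourings_removals:
  assumes "\<alpha> N \<noteq> 0" "finite {k. \<alpha> k \<noteq> 0}"
  shows "block_colourings L \<alpha> = (\<Sum>L'\<leftarrow>removals (\<alpha> N) L. block_colourings L' (\<alpha>(N := 0)))"
  using assms
proof (induction L arbitrary: \<alpha>)
  case Nil
  then have "\<alpha> \<noteq> (\<lambda>_. 0)" by auto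
  then show ?case by simp
next
  case (Cons x L)
  define K where "K = {k. (\<alpha>(N := 0)) k \<noteq> 0 \<and> (\<alpha>(N := 0)) k = x}"
  have fin: "finite K" by (rule finite_subset[OF _ Cons.prems(2)]) (auto simp: K_def)
  have N: "N \<notin> K" by (simp add: K_def)
  have IH: "block_colourings L (\<alpha>(k := 0)) = (\<Sum>L'\<leftarrow>removals (\<alpha> N) L. block_colourings L' (\<alpha>(N := 0, k := 0)))"
    if "k \<in> K" for k
  proof -
    from that N have "k \<noteq> N" by blast
    moreover have "finite {l. (\<alpha>(k := 0)) l \<noteq> 0}"
      by (rule finite_subset[OF _ Cons.prems(2)]) auto
    moreover from \<open>k \<noteq> N\<close> have "(\<alpha>(k := 0)) N = \<alpha> N" by simp
    ultimately show ?thesis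
      using Cons.IH[of "\<alpha>(k := 0)"] Cons.prems(1) fun_upd_twist[of k N \<alpha> 0 0] by metis
  qed
  have eq: "{k. \<alpha> k \<noteq> 0 \<and> \<alpha> k = x} = (if x = \<alpha> N then insert N K else K)"
    using Cons.prems(1) by (auto simp: K_def)
  have "block_colourings (x # L) \<alpha> = (if x = \<alpha> N then block_colourings L (\<alpha>(N := 0)) else 0) +
      (\<Sum>k\<in>K. block_colourings L (\<alpha>(k := 0)))"
    unfolding block_colourings.simps eq by (cases "x = \<alpha> N") (simp_all only: sum.insert[OF fin N] simp_thms if_True if_False add_0)
  also have "(\<Sum>k\<in>K. block_colourings L (\<alpha>(k := 0))) =
      (\<Sum>k\<in>K. \<Sum>L'\<leftarrow>removals (\<alpha> N) L. block_colourings L' (\<alpha>(N := 0, k := 0)))"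
    using IH by (rule sum.cong[OF refl])
  also have "\<dots> = (\<Sum>L'\<leftarrow>removals (\<alpha> N) L. \<Sum>k\<in>K. block_colourings L' (\<alpha>(N := 0, k := 0)))"
    by (rule sum_sum_list)
  also have "(\<lambda>L'. \<Sum>k\<in>K. block_colourings L' (\<alpha>(N := 0, k := 0))) = (\<lambda>L'. block_colourings (x # L') (\<alpha>(N := 0)))"
    unfolding K_def block_colourings.simps ..
  finally show ?case by (simp add: o_def del: block_colourings.simps fun_upd_apply)
qed

section \<open>Colourings with prescribed colour classes\<close>

fun has_classes :: "'v list list \<Rightarrow> ('v \<Rightarrow> nat) \<Rightarrow> bool" where
  "has_classes [] \<kappa> = True"
| "has_classes (B # \<pi>) \<kappa> = ((\<exists>c. \<forall>u\<in>set B. \<kappa> u = c) \<and>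
     (\<forall>u\<in>set B. \<forall>w\<in>set (concat \<pi>). \<kappa> u \<noteq> \<kappa> w) \<and> has_classes \<pi> \<kappa>)"

lemma finite_colourings:
  assumes "finite V" "finite {k. \<alpha> k \<noteq> 0}"
  shows "finite {\<kappa>. (\<forall>v. v \<notin> V \<longrightarrow> \<kappa> v = 0) \<and> (\<forall>k. card {v \<in> V. \<kappa> v = k} = \<alpha> k)}"
proof (rule finite_subset[OF subsetI])
  show "finite {\<kappa>. \<forall>v. (v \<in> V \<longrightarrow> \<kappa> v \<in> {k. \<alpha> k \<noteq> 0}) \<and> (v \<notin> V \<longrightarrow> \<kappa> v = 0)}"
    using finite_set_of_finite_funs[OF assms] .
next
  fix \<kappa> assume "\<kappa> \<in> {\<kappa>. (\<forall>v. v \<notin> V \<longrightarrow> \<kappa> v = 0) \<and> (\<forall>k. card {v \<in> V. \<kappa> v = k} = \<alpha> k)}"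
  then have *: "\<forall>v. v \<notin> V \<longrightarrow> \<kappa> v = 0" "\<forall>k. card {v \<in> V. \<kappa> v = k} = \<alpha> k" by blast+
  with fibre_support[OF assms(1) *(2)]
  show "\<kappa> \<in> {\<kappa>. \<forall>v. (v \<in> V \<longrightarrow> \<kappa> v \<in> {k. \<alpha> k \<noteq> 0}) \<and> (v \<notin> V \<longrightarrow> \<kappa> v = 0)}"
    by blast
qed

definition class_colourings :: "'v list list \<Rightarrow> (nat \<Rightarrow> nat) \<Rightarrow> ('v \<Rightarrow> nat) set" where
  "class_colourings \<pi> \<alpha> = {\<kappa>. (\<forall>v. v \<notin> set (concat \<pi>) \<longrightarrow> \<kappa> v = 0) \<and>
     (\<forall>k. card {v \<in> set (concat \<pi>). \<kappa> v = k} = \<alpha> k) \<and> has_classes \<pi> \<kappa>}"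

lemma finite_class_colourings:
  "finite {k. \<alpha> k \<noteq> 0} \<Longrightarrow> finite (class_colourings \<pi> \<alpha>)"
  by (rule finite_subset[OF _ finite_colourings[of "set (concat \<pi>)" \<alpha>]])
     (auto simp: class_colourings_def)

lemma has_classes_cong: "(\<And>v. v \<in> set (concat \<pi>) \<Longrightarrow> \<kappa> v = \<kappa>' v) \<Longrightarrow> has_classes \<pi> \<kappa> = has_classes \<pi> \<kappa>'"
  by (induction \<pi>) auto

text \<open>A colouring with the classes \<pi> amounts to an injective choice of colours for the
  blocks. The colour of the first block is split off and the block is reset to 0, which keeps the
  remaining colouring extensional.\<close>

lemma card_class_colourings:
  assumes "finite {k. \<alpha> k \<noteq> 0}" "distinct (concat \<pi>)" "[] \<notin> set \<pi>"
  shows "card (class_colourings \<pi> \<alpha>) = block_colourings (map length \<pi>) \<alpha>"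
  using assms
proof (induction \<pi> arbitrary: \<alpha>)
  case Nil
  have eq: "class_colourings [] \<alpha> = (if \<alpha> = (\<lambda>_. 0) then {\<lambda>_. 0} else {})"
    by (auto simp: class_colourings_def)
  show ?case
    unfolding eq by (simp add: of_bool_def)
next
  case (Cons B \<pi>)
  let ?K = "{k. \<alpha> k \<noteq> 0 \<and> \<alpha> k = length B}"
  define W where "W = set (concat \<pi>)"
  have mem: "\<kappa> \<in> class_colourings (B # \<pi>) \<alpha> \<longleftrightarrow>
      (\<forall>v. v \<notin> set B \<union> W \<longrightarrow> \<kappa> v = 0) \<and> (\<forall>k. card {v \<in> set B \<union> W. \<kappa> v = k} = \<alpha> k) \<and>
      (\<exists>c. \<forall>u\<in>set B. \<kappa> u = c) \<and> (\<forall>u\<in>set B. \<forall>w\<in>W. \<kappa> u \<noteq> \<kappa> w) \<and> has_classes \<pi> \<kappa>" for \<kappa>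
    unfolding class_colourings_def W_def has_classes.simps concat.simps set_append mem_Collect_eq ..
  have mem': "\<kappa> \<in> class_colourings \<pi> \<beta> \<longleftrightarrow>
      (\<forall>v. v \<notin> W \<longrightarrow> \<kappa> v = 0) \<and> (\<forall>k. card {v \<in> W. \<kappa> v = k} = \<beta> k) \<and> has_classes \<pi> \<kappa>" for \<kappa> \<beta>
    unfolding class_colourings_def W_def mem_Collect_eq ..
  let ?S = "SIGMA c:?K. class_colourings \<pi> (\<alpha>(c := 0))"
  define F where "F \<kappa> = (\<kappa> (hd B), \<lambda>v. if v \<in> set B then 0 else \<kappa> v)" for \<kappa> :: "'a \<Rightarrow> nat"
  define G where "G = (\<lambda>(c, \<kappa>) v. if v \<in> set B then c else \<kappa> v :: nat)"
  have B: "B \<noteq> []" "distinct B" "set B \<inter> W = {}" using Cons.prems by (auto simp: W_def)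
  then have cB: "card (set B) = length B" "length B \<noteq> 0" by (simp_all add: distinct_card)
  have F: "F \<kappa> \<in> ?S" "G (F \<kappa>) = \<kappa>" if \<kappa>: "\<kappa> \<in> class_colourings (B # \<pi>) \<alpha>" for \<kappa>
  proof -
    from \<kappa> have z: "\<forall>v. v \<notin> set B \<union> W \<longrightarrow> \<kappa> v = 0"
      and n: "\<And>k. card {v \<in> set B \<union> W. \<kappa> v = k} = \<alpha> k"
      and ker: "\<exists>c. \<forall>u\<in>set B. \<kappa> u = c" "\<forall>u\<in>set B. \<forall>w\<in>W. \<kappa> u \<noteq> \<kappa> w" "has_classes \<pi> \<kappa>"
      unfolding mem by blast+
    have c: "\<kappa> v = \<kappa> (hd B)" if "v \<in> set B" for v using ker(1) that B(1) by (metis hd_in_set)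
    have out: "\<kappa> w \<noteq> \<kappa> (hd B)" if "w \<in> W" for w using ker(2) that B(1) by (metis hd_in_set)
    have "{v \<in> set B \<union> W. \<kappa> v = \<kappa> (hd B)} = set B" using c out by blast
    with n[of "\<kappa> (hd B)"] cB(1) have "\<alpha> (\<kappa> (hd B)) = length B" by argo
    with cB(2) have inK: "\<kappa> (hd B) \<in> ?K" by (simp only: mem_Collect_eq) blast
    have eq: "snd (F \<kappa>) w = \<kappa> w" if "w \<in> W" for w using that B(3) by (auto simp: F_def)
    have "{v \<in> W. snd (F \<kappa>) v = k} = (if k = \<kappa> (hd B) then {} else {v \<in> set B \<union> W. \<kappa> v = k})" for k
      using eq c out by auto
    then have "card {v \<in> W. snd (F \<kappa>) v = k} = (\<alpha>(\<kappa> (hd B) := 0)) k" for k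
      using n[of k] by simp
    moreover have "has_classes \<pi> (snd (F \<kappa>))" using ker(3) has_classes_cong[of \<pi> \<kappa> "snd (F \<kappa>)"] eq by (simp add: W_def)
    moreover have "\<forall>v. v \<notin> W \<longrightarrow> snd (F \<kappa>) v = 0" using z by (simp add: F_def)
    ultimately have "snd (F \<kappa>) \<in> class_colourings \<pi> (\<alpha>(\<kappa> (hd B) := 0))"
      unfolding mem' by blast
    with inK show "F \<kappa> \<in> ?S" unfolding F_def snd_conv by (intro SigmaI)
    show "G (F \<kappa>) = \<kappa>" using c by (auto simp: F_def G_def)
  qed
  have G: "G (c, \<kappa>) \<in> class_colourings (B # \<pi>) \<alpha>" "F (G (c, \<kappa>)) = (c, \<kappa>)"
    if c: "c \<in> ?K" and \<kappa>: "\<kappa> \<in> class_colourings \<pi> (\<alpha>(c := 0))" for c \<kappa>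
  proof -
    from \<kappa> have z: "\<forall>v. v \<notin> W \<longrightarrow> \<kappa> v = 0"
      and n: "\<And>k. card {v \<in> W. \<kappa> v = k} = (\<alpha>(c := 0)) k" and ker: "has_classes \<pi> \<kappa>"
      unfolding mem' by blast+
    have inB: "G (c, \<kappa>) v = c" if "v \<in> set B" for v using that by (simp add: G_def)
    have inW: "G (c, \<kappa>) v = \<kappa> v" if "v \<in> W" for v using that B(3) by (auto simp: G_def)
    have "finite {w \<in> W. \<kappa> w = c}" by (simp add: W_def)
    from card_0_eq[OF this] have "{w \<in> W. \<kappa> w = c} = {}" using n[of c] by (simp only: fun_upd_same simp_thms)
    then have ne: "\<kappa> w \<noteq> c" if "w \<in> W" for w using that by blast
    have "{v \<in> set B \<union> W. G (c, \<kappa>) v = k} =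
        (if k = c then set B else {v \<in> W. \<kappa> v = k})" for k
      using inB inW ne by auto
    then have "card {v \<in> set B \<union> W. G (c, \<kappa>) v = k} = \<alpha> k" for k
      using n[of k] c cB by simp
    moreover have "has_classes \<pi> (G (c, \<kappa>))"
      using ker has_classes_cong[of \<pi> \<kappa> "G (c, \<kappa>)"] inW by (simp add: W_def)
    moreover have "\<exists>c'. \<forall>u\<in>set B. G (c, \<kappa>) u = c'" using inB by blast
    moreover have "\<forall>u\<in>set B. \<forall>w\<in>W. G (c, \<kappa>) u \<noteq> G (c, \<kappa>) w" using inB inW ne by metis
    moreover have "\<forall>v. v \<notin> set B \<union> W \<longrightarrow> G (c, \<kappa>) v = 0" using z by (simp add: G_def)
    ultimately show "G (c, \<kappa>) \<in> class_colourings (B # \<pi>) \<alpha>"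
      unfolding mem by blast
    have "\<kappa> v = 0" if "v \<in> set B" for v using z B(3) that by blast
    then show "F (G (c, \<kappa>)) = (c, \<kappa>)" using B(1) by (auto simp: F_def G_def)
  qed
  have fin: "finite ?K" by (rule finite_subset[OF _ Cons.prems(1)]) auto
  have fin': "finite {l. (\<alpha>(k := 0)) l \<noteq> 0}" for k
    by (rule finite_subset[OF _ Cons.prems(1)]) auto
  have "bij_betw F (class_colourings (B # \<pi>) \<alpha>) ?S"
  proof (rule bij_betw_byWitness[of _ G])
    show "\<forall>\<kappa>\<in>class_colourings (B # \<pi>) \<alpha>. G (F \<kappa>) = \<kappa>" using F(2) by blast
    show "\<forall>p\<in>?S. F (G p) = p" using G(2) by fast
    show "F ` class_colourings (B # \<pi>) \<alpha> \<subseteq> ?S" using F(1) by (rule image_subsetI)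
    show "G ` ?S \<subseteq> class_colourings (B # \<pi>) \<alpha>" using G(1) by fast
  qed
  then have "card (class_colourings (B # \<pi>) \<alpha>) = card ?S" by (rule bij_betw_same_card)
  also have "\<dots> = (\<Sum>c\<in>?K. card (class_colourings \<pi> (\<alpha>(c := 0))))"
    using fin fin' by (simp add: finite_class_colourings)
  also have "\<dots> = (\<Sum>c\<in>?K. block_colourings (map length \<pi>) (\<alpha>(c := 0)))"
    using Cons.prems by (intro sum.cong refl Cons.IH[OF fin']) simp_all
  finally show ?case by simp
qed

section \<open>Enumeration of stable partitions\<close>

fun joins :: "('v \<Rightarrow> 'v \<Rightarrow> bool) \<Rightarrow> 'v \<Rightarrow> 'v list list \<Rightarrow> 'v list list list" where
  "joins E v [] = []"
| "joins E v (B # \<pi>) =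
     (if list_all (\<lambda>u. \<not> E v u) B then [(v # B) # \<pi>] else []) @ map ((#) B) (joins E v \<pi>)"

text \<open>The bound \<open>k\<close> prunes partitions with more blocks than available colours.
  This is safe at every stage, because restricting a partition to fewer vertices never increases the
  number of blocks.\<close>

fun stable_partitions :: "('v \<Rightarrow> 'v \<Rightarrow> bool) \<Rightarrow> nat \<Rightarrow> 'v list \<Rightarrow> 'v list list list" where
  "stable_partitions E k [] = [[]]"
| "stable_partitions E k (v # vs) = concat (map (\<lambda>\<pi>.
     (if length \<pi> < k then [[v] # \<pi>] else []) @ joins E v \<pi>) (stable_partitions E k vs))"

lemma has_classes_card_image:
  "has_classes \<pi> \<kappa> \<Longrightarrow> [] \<notin> set \<pi> \<Longrightarrow> card (\<kappa> ` set (concat \<pi>)) = length \<pi>"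
proof (induction \<pi>)
  case (Cons B \<pi>)
  then obtain c where c: "\<And>u. u \<in> set B \<Longrightarrow> \<kappa> u = c" by auto
  from Cons.prems have B: "B \<noteq> []" by auto
  have "\<kappa> ` set B = {c}" using c B by (cases B) auto
  moreover have "c \<notin> \<kappa> ` set (concat \<pi>)"
    using Cons.prems(1) B c[of "hd B"] by (cases B) auto
  ultimately show ?case using Cons by (simp add: image_Un)
qed simp

lemma set_joins:
  assumes "\<pi>' \<in> set (joins E v \<pi>)"
  shows "set (concat \<pi>') = insert v (set (concat \<pi>))"
    "[] \<notin> set \<pi> \<Longrightarrow> [] \<notin> set \<pi>'"
    "distinct (concat \<pi>) \<Longrightarrow> v \<notin> set (concat \<pi>) \<Longrightarrow> distinct (concat \<pi>')"
proof -
  have "set (concat \<pi>') = insert v (set (concat \<pi>)) \<and> ([] \<notin> set \<pi> \<longrightarrow> [] \<notin> set \<pi>') \<and>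
    (distinct (concat \<pi>) \<longrightarrow> v \<notin> set (concat \<pi>) \<longrightarrow> distinct (concat \<pi>'))"
    using assms
  proof (induction \<pi> arbitrary: \<pi>')
    case (Cons B \<pi>)
    consider "\<pi>' = (v # B) # \<pi>" | \<pi>'' where "\<pi>' = B # \<pi>''" "\<pi>'' \<in> set (joins E v \<pi>)"
      using Cons.prems by (auto split: if_splits)
    then show ?case
    proof cases
      case 2
      from Cons.IH[OF 2(2)] show ?thesis unfolding 2(1) concat.simps set_append distinct_append by auto
    qed auto
  qed simp
  then show "set (concat \<pi>') = insert v (set (concat \<pi>))"
    "[] \<notin> set \<pi> \<Longrightarrow> [] \<notin> set \<pi>'"
    "distinct (concat \<pi>) \<Longrightarrow> v \<notin> set (concat \<pi>) \<Longrightarrow> distinct (concat \<pi>')" by blast+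
qed

lemma stable_partitions_invariants:
  assumes "\<pi> \<in> set (stable_partitions E k vs)" "distinct vs"
  shows "set (concat \<pi>) = set vs \<and> [] \<notin> set \<pi> \<and> distinct (concat \<pi>)"
  using assms
proof (induction vs arbitrary: \<pi>)
  case (Cons v vs)
  obtain \<pi>0 where \<pi>0: "\<pi>0 \<in> set (stable_partitions E k vs)" "\<pi> = [v] # \<pi>0 \<or> \<pi> \<in> set (joins E v \<pi>0)"
    using Cons.prems(1) by (auto split: if_splits)
  have IH: "set (concat \<pi>0) = set vs" "[] \<notin> set \<pi>0" "distinct (concat \<pi>0)"
    using Cons.IH[OF \<pi>0(1)] Cons.prems(2) by simp_all
  have v: "v \<notin> set (concat \<pi>0)" using Cons.prems(2) unfolding IH(1) by simp
  from \<pi>0(2) show ?case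
  proof
    assume "\<pi> = [v] # \<pi>0"
    with IH v show ?thesis by auto
  next
    assume "\<pi> \<in> set (joins E v \<pi>0)"
    from set_joins[OF this] IH v show ?thesis by (simp del: set_concat)
  qed
qed simp

text \<open>At most one term is nonzero: \<kappa> gives distinct colours to distinct blocks of
  \<pi>, and only the block coloured \<open>\<kappa> v\<close> can receive \<open>v\<close>.\<close>

lemma sum_has_classes_joins:
  assumes "[] \<notin> set \<pi>"
  shows "(\<Sum>\<pi>'\<leftarrow>joins E v \<pi>. of_bool (has_classes \<pi>' \<kappa>)) = (of_bool (has_classes \<pi> \<kappa> \<and>
     \<kappa> v \<in> \<kappa> ` set (concat \<pi>) \<and> (\<forall>u\<in>set (concat \<pi>). E v u \<longrightarrow> \<kappa> u \<noteq> \<kappa> v)) :: nat)"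
  using assms
proof (induction \<pi>)
  case (Cons B \<pi>)
  define W where "W = set (concat \<pi>)"
  have W: "set (concat (B # \<pi>)) = set B \<union> W" by (simp add: W_def)
  have B: "B \<noteq> []" "[] \<notin> set \<pi>" using Cons.prems by auto
  let ?P = "(\<exists>c. \<forall>u\<in>set B. \<kappa> u = c) \<and> (\<forall>u\<in>set B. \<forall>w\<in>insert v W. \<kappa> u \<noteq> \<kappa> w)"
  have "has_classes (B # \<pi>') \<kappa> \<longleftrightarrow> ?P \<and> has_classes \<pi>' \<kappa>" if "\<pi>' \<in> set (joins E v \<pi>)" for \<pi>'
    using set_joins(1)[OF that] by (auto simp only: has_classes.simps W_def)
  then have "(\<Sum>\<pi>'\<leftarrow>joins E v \<pi>. of_bool (has_classes (B # \<pi>') \<kappa>)) =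
      (\<Sum>\<pi>'\<leftarrow>joins E v \<pi>. of_bool ?P * (of_bool (has_classes \<pi>' \<kappa>) :: nat))"
    by (intro arg_cong[where f = sum_list] map_cong refl) (simp only: of_bool_conj)
  also have "\<dots> = of_bool ?P * of_bool (has_classes \<pi> \<kappa> \<and> \<kappa> v \<in> \<kappa> ` W \<and> (\<forall>u\<in>W. E v u \<longrightarrow> \<kappa> u \<noteq> \<kappa> v))"
    unfolding W_def Cons.IH[OF B(2), symmetric] by (rule sum_list_const_mult)
  also have "\<dots> = of_bool (?P \<and> has_classes \<pi> \<kappa> \<and> \<kappa> v \<in> \<kappa> ` W \<and> (\<forall>u\<in>W. E v u \<longrightarrow> \<kappa> u \<noteq> \<kappa> v))"
    by (simp only: of_bool_conj)
  finally have tail: "(\<Sum>\<pi>'\<leftarrow>joins E v \<pi>. of_bool (has_classes (B # \<pi>') \<kappa>)) =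
     (of_bool (?P \<and> has_classes \<pi> \<kappa> \<and> \<kappa> v \<in> \<kappa> ` W \<and> (\<forall>u\<in>W. E v u \<longrightarrow> \<kappa> u \<noteq> \<kappa> v)) :: nat)" .
  let ?Q = "(\<forall>u\<in>set B. \<not> E v u) \<and> (\<forall>u\<in>set B. \<kappa> u = \<kappa> v) \<and> (\<forall>w\<in>W. \<kappa> w \<noteq> \<kappa> v) \<and> has_classes \<pi> \<kappa>"
  have "has_classes ((v # B) # \<pi>) \<kappa> \<longleftrightarrow> (\<forall>u\<in>set B. \<kappa> u = \<kappa> v) \<and> (\<forall>w\<in>W. \<kappa> w \<noteq> \<kappa> v) \<and> has_classes \<pi> \<kappa>"
    unfolding has_classes.simps W_def[symmetric] list.set by (auto 4 3)
  then have "(\<Sum>\<pi>'\<leftarrow>joins E v (B # \<pi>). of_bool (has_classes \<pi>' \<kappa>)) = of_bool ?Q +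
     (of_bool (?P \<and> has_classes \<pi> \<kappa> \<and> \<kappa> v \<in> \<kappa> ` W \<and> (\<forall>u\<in>W. E v u \<longrightarrow> \<kappa> u \<noteq> \<kappa> v)) :: nat)"
    unfolding tail[symmetric] by (simp add: list_all_iff o_def del: has_classes.simps)
  also have "\<dots> = of_bool (has_classes (B # \<pi>) \<kappa> \<and> \<kappa> v \<in> \<kappa> ` (set B \<union> W) \<and>
      (\<forall>u\<in>set B \<union> W. E v u \<longrightarrow> \<kappa> u \<noteq> \<kappa> v))"
  proof (cases "has_classes (B # \<pi>) \<kappa>")
    case False
    then have nk: "\<not> ((\<exists>c. \<forall>u\<in>set B. \<kappa> u = c) \<and> (\<forall>u\<in>set B. \<forall>w\<in>W. \<kappa> u \<noteq> \<kappa> w) \<and> has_classes \<pi> \<kappa>)"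
      unfolding has_classes.simps W_def .
    have nq: "\<not> ?Q"
    proof
      assume Q: ?Q
      then have "\<exists>c. \<forall>u\<in>set B. \<kappa> u = c" by blast
      moreover from Q have "\<forall>u\<in>set B. \<forall>w\<in>W. \<kappa> u \<noteq> \<kappa> w" by auto
      ultimately show False using Q nk by blast
    qed
    from nk have np: "\<not> (?P \<and> has_classes \<pi> \<kappa> \<and> \<kappa> v \<in> \<kappa> ` W \<and> (\<forall>u\<in>W. E v u \<longrightarrow> \<kappa> u \<noteq> \<kappa> v))" by blast
    show ?thesis
      unfolding Eq_FalseI[OF nq] Eq_FalseI[OF np] Eq_FalseI[OF False] by simp
  next
    case True
    then have ker: "\<exists>c. \<forall>u\<in>set B. \<kappa> u = c" "\<forall>u\<in>set B. \<forall>w\<in>W. \<kappa> u \<noteq> \<kappa> w" "has_classes \<pi> \<kappa>"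
      unfolding has_classes.simps W_def[symmetric] by blast+
    obtain b where b: "b \<in> set B" using B(1) by (cases B) auto
    have c: "\<kappa> u = \<kappa> b" if "u \<in> set B" for u using ker(1) that b by metis
    show ?thesis
    \<comment> \<open>If \<open>v\<close> has the colour of the first block, only the partition
      joining \<open>v\<close> to \<open>B\<close> can count; otherwise only those joining it to a
      later block.\<close>
    proof (cases "\<kappa> v = \<kappa> b")
      case vb: True
      then have "\<not> ?P" using b by force
      then have np: "\<not> (?P \<and> has_classes \<pi> \<kappa> \<and> \<kappa> v \<in> \<kappa> ` W \<and> (\<forall>u\<in>W. E v u \<longrightarrow> \<kappa> u \<noteq> \<kappa> v))" by blast
      have Q: "?Q = (\<forall>u\<in>set B \<union> W. E v u \<longrightarrow> \<kappa> u \<noteq> \<kappa> v)"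
        using vb c ker(2,3) b by (metis Un_iff)
      have v: "\<kappa> v \<in> \<kappa> ` (set B \<union> W)" using vb b by blast
      show ?thesis
        unfolding Eq_FalseI[OF np] Q Eq_TrueI[OF True] Eq_TrueI[OF v] by simp
    next
      case vb: False
      then have nq: "\<not> ?Q" using b by metis
      have "?P" using ker vb c by (metis insert_iff)
      then have P: "(?P \<and> has_classes \<pi> \<kappa> \<and> \<kappa> v \<in> \<kappa> ` W \<and> (\<forall>u\<in>W. E v u \<longrightarrow> \<kappa> u \<noteq> \<kappa> v)) =
          (\<kappa> v \<in> \<kappa> ` W \<and> (\<forall>u\<in>W. E v u \<longrightarrow> \<kappa> u \<noteq> \<kappa> v))" using ker(3) by blast
      have im: "\<kappa> v \<in> \<kappa> ` (set B \<union> W) \<longleftrightarrow> \<kappa> v \<in> \<kappa> ` W" using vb c by force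
      have adj: "(\<forall>u\<in>set B \<union> W. E v u \<longrightarrow> \<kappa> u \<noteq> \<kappa> v) = (\<forall>u\<in>W. E v u \<longrightarrow> \<kappa> u \<noteq> \<kappa> v)"
        using vb c by (metis Un_iff)
      show ?thesis
        unfolding Eq_FalseI[OF nq] P im adj Eq_TrueI[OF True] by simp
    qed
  qed
  finally show ?case unfolding W .
qed simp

text \<open>A proper colouring with at most \<open>k\<close> colours has exactly one partition into
  colour classes, and that partition is stable. A sum of indicators states existence and uniqueness
  in one equation, without comparing blocks listed in different orders.\<close>

lemma sum_has_classes_stable_partitions:
  assumes "distinct vs" "symp E" "irreflp E"
  shows "(\<Sum>\<pi>\<leftarrow>stable_partitions E k vs. of_bool (has_classes \<pi> \<kappa>)) =
    (of_bool ((\<forall>u\<in>set vs. \<forall>w\<in>set vs. E u w \<longrightarrow> \<kappa> u \<noteq> \<kappa> w) \<and> card (\<kappa> ` set vs) \<le> k) :: nat)"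
  using assms(1)
proof (induction vs)
  case (Cons v vs)
  let ?proper = "\<lambda>V. \<forall>u\<in>V. \<forall>w\<in>V. E u w \<longrightarrow> \<kappa> u \<noteq> \<kappa> w"
  \<comment> \<open>The condition on the colour of \<open>v\<close> alone. Its second half matches
    the test \<open>length \<pi> < k\<close>, since \<pi> has as many blocks as there are colours on
    \<open>vs\<close>.\<close>
  let ?new = "(\<forall>u\<in>set vs. E v u \<longrightarrow> \<kappa> u \<noteq> \<kappa> v) \<and> (\<kappa> v \<notin> \<kappa> ` set vs \<longrightarrow> card (\<kappa> ` set vs) < k)"
  have step: "(\<Sum>\<pi>'\<leftarrow>(if length \<pi> < k then [[v] # \<pi>] else []) @ joins E v \<pi>. of_bool (has_classes \<pi>' \<kappa>)) =
      of_bool ?new * (of_bool (has_classes \<pi> \<kappa>) :: nat)"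
    if \<pi>: "\<pi> \<in> set (stable_partitions E k vs)" for \<pi>
  proof -
    have inv: "set (concat \<pi>) = set vs" "[] \<notin> set \<pi>"
      using stable_partitions_invariants[OF \<pi>] Cons.prems by simp_all
    have new: "has_classes ([v] # \<pi>) \<kappa> \<longleftrightarrow> \<kappa> v \<notin> \<kappa> ` set vs \<and> has_classes \<pi> \<kappa>"
      unfolding has_classes.simps inv(1) by auto
    show ?thesis
    proof (cases "has_classes \<pi> \<kappa>")
      case True
      with has_classes_card_image[OF True inv(2)] show ?thesis
        unfolding map_append sum_list_append sum_has_classes_joins[OF inv(2)] inv(1)
        by (cases "\<kappa> v \<in> \<kappa> ` set vs") (auto simp: new image_iff simp del: has_classes.simps)
    next
      case False
      then show ?thesis
        unfolding map_append sum_list_append sum_has_classes_joins[OF inv(2)] inv(1)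
        by (simp add: new del: has_classes.simps)
    qed
  qed
  have proper: "?proper (set (v # vs)) \<longleftrightarrow> ?proper (set vs) \<and> (\<forall>u\<in>set vs. E v u \<longrightarrow> \<kappa> u \<noteq> \<kappa> v)"
  proof
    assume "?proper (set (v # vs))"
    then show "?proper (set vs) \<and> (\<forall>u\<in>set vs. E v u \<longrightarrow> \<kappa> u \<noteq> \<kappa> v)" by force
  next
    assume R: "?proper (set vs) \<and> (\<forall>u\<in>set vs. E v u \<longrightarrow> \<kappa> u \<noteq> \<kappa> v)"
    show "?proper (set (v # vs))"
    proof (intro ballI impI)
      fix u w assume uw: "u \<in> set (v # vs)" "w \<in> set (v # vs)" "E u w"
      with assms(3) have "u \<noteq> w" by (auto simp: irreflp_def)
      moreover from assms(2) uw(3) have "E w u" by (auto dest: sympD)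
      ultimately show "\<kappa> u \<noteq> \<kappa> w" using R uw by (auto; metis)
    qed
  qed
  have "card (\<kappa> ` set (v # vs)) \<le> k \<longleftrightarrow>
      card (\<kappa> ` set vs) \<le> k \<and> (\<kappa> v \<notin> \<kappa> ` set vs \<longrightarrow> card (\<kappa> ` set vs) < k)"
    by (cases "\<kappa> v \<in> \<kappa> ` set vs") (auto simp: insert_absorb)
  with proper have eq: "?proper (set (v # vs)) \<and> card (\<kappa> ` set (v # vs)) \<le> k \<longleftrightarrow>
      ?new \<and> ?proper (set vs) \<and> card (\<kappa> ` set vs) \<le> k" by blast
  have "(\<Sum>\<pi>\<leftarrow>stable_partitions E k (v # vs). of_bool (has_classes \<pi> \<kappa>) :: nat) =
      (\<Sum>\<pi>\<leftarrow>stable_partitions E k vs.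
        \<Sum>\<pi>'\<leftarrow>(if length \<pi> < k then [[v] # \<pi>] else []) @ joins E v \<pi>. of_bool (has_classes \<pi>' \<kappa>))"
    unfolding stable_partitions.simps map_concat map_map o_def sum_list_concat_map ..
  also have "\<dots> = (\<Sum>\<pi>\<leftarrow>stable_partitions E k vs. of_bool ?new * of_bool (has_classes \<pi> \<kappa>))"
    by (intro arg_cong[where f = sum_list] map_cong refl) (erule step)
  also have "\<dots> = of_bool ?new * (\<Sum>\<pi>\<leftarrow>stable_partitions E k vs. of_bool (has_classes \<pi> \<kappa>))"
    by (rule sum_list_const_mult)
  also have "\<dots> = of_bool (?new \<and> ?proper (set vs) \<and> card (\<kappa> ` set vs) \<le> k)"
    using Cons by (simp only: distinct.simps of_bool_conj)
  finally show ?case unfolding eq .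
qed simp

text \<open>Double counting of pairs of a colouring with class sizes \<alpha> and the stable
  partition formed by its classes. Restricting to \<open>K\<close> blocks loses nothing, as the
  colours used form the support of \<alpha>.\<close>

lemma chrom_coeff_stable_partitions:
  assumes "distinct vs" "symp E" "irreflp E" "finite {k. \<alpha> k \<noteq> 0}" "card {k. \<alpha> k \<noteq> 0} \<le> K"
  shows "chrom_coeff (set vs) E \<alpha> = (\<Sum>\<pi>\<leftarrow>stable_partitions E K vs. block_colourings (map length \<pi>) \<alpha>)"
proof -
  define U where "U = {\<kappa>. (\<forall>v. v \<notin> set vs \<longrightarrow> \<kappa> v = 0) \<and> (\<forall>k. card {v \<in> set vs. \<kappa> v = k} = \<alpha> k)}"
  let ?proper = "\<lambda>\<kappa>. \<forall>u\<in>set vs. \<forall>w\<in>set vs. E u w \<longrightarrow> \<kappa> u \<noteq> \<kappa> w"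
  have fin: "finite U" unfolding U_def using assms(4) by (intro finite_colourings) auto
  have supp: "card (\<kappa> ` set vs) \<le> K" if "\<kappa> \<in> U" for \<kappa>
    using fibre_support[of "set vs" \<kappa> \<alpha>] that assms(5) by (simp add: U_def)
  have "chrom_coeff (set vs) E \<alpha> = card (U \<inter> {\<kappa>. ?proper \<kappa>})"
    unfolding chrom_coeff_def
    by (intro arg_cong[where f = card] set_eqI) (simp only: U_def mem_Collect_eq Int_iff conj_ac)
  also have "\<dots> = (\<Sum>\<kappa>\<in>U. of_bool (?proper \<kappa>))"
    by (subst sum_of_bool_eq) (simp_all only: fin of_nat_id)
  also have "\<dots> = (\<Sum>\<kappa>\<in>U. \<Sum>\<pi>\<leftarrow>stable_partitions E K vs. of_bool (has_classes \<pi> \<kappa>))"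
    using supp by (intro sum.cong refl) (simp only: sum_has_classes_stable_partitions[OF assms(1-3)] simp_thms)
  also have "\<dots> = (\<Sum>\<pi>\<leftarrow>stable_partitions E K vs. \<Sum>\<kappa>\<in>U. of_bool (has_classes \<pi> \<kappa>))"
    by (rule sum_sum_list)
  also have "\<dots> = (\<Sum>\<pi>\<leftarrow>stable_partitions E K vs. block_colourings (map length \<pi>) \<alpha>)"
  proof (intro arg_cong[where f = sum_list] map_cong refl)
    fix \<pi> assume "\<pi> \<in> set (stable_partitions E K vs)"
    from stable_partitions_invariants[OF this assms(1)]
    have inv: "set (concat \<pi>) = set vs" "[] \<notin> set \<pi>" "distinct (concat \<pi>)" by blast+
    have "(\<Sum>\<kappa>\<in>U. of_bool (has_classes \<pi> \<kappa>)) = card (U \<inter> {\<kappa>. has_classes \<pi> \<kappa>})"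
      by (subst sum_of_bool_eq) (simp_all only: fin of_nat_id)
    also have "U \<inter> {\<kappa>. has_classes \<pi> \<kappa>} = class_colourings \<pi> \<alpha>"
      unfolding class_colourings_def inv(1)
      by (intro set_eqI) (simp only: U_def mem_Collect_eq Int_iff conj_ac)
    finally show "(\<Sum>\<kappa>\<in>U. of_bool (has_classes \<pi> \<kappa>)) = block_colourings (map length \<pi>) \<alpha>"
      using card_class_colourings[OF assms(4) inv(3,2)] by simp
  qed
  finally show ?thesis .
qed

section \<open>Types of stable partitions\<close>

lemma block_colourings_swap:
  assumes "finite {k. \<alpha> k \<noteq> 0}"
  shows "block_colourings (x # y # L) \<alpha> = block_colourings (y # x # L) \<alpha>"
proof -
  define S where "S x = {k. \<alpha> k \<noteq> 0 \<and> \<alpha> k = x}" for x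
  have fin: "finite (S x)" for x
    by (rule finite_subset[OF _ assms]) (auto simp: S_def)
  \<comment> \<open>Distinctness of the two colours is written as a zero summand, so that the sum
    runs over a full rectangle and can be interchanged.\<close>
  have *: "block_colourings (x # y # L) \<alpha> = (\<Sum>k\<in>S x. \<Sum>l\<in>S y. if k = l then 0 else block_colourings L (\<alpha>(k := 0, l := 0)))" for x y
  proof -
    have "{l. (\<alpha>(k := 0)) l \<noteq> 0 \<and> (\<alpha>(k := 0)) l = y} = S y - {k}" for k
      by (auto simp: S_def)
    then have "block_colourings (x # y # L) \<alpha> = (\<Sum>k\<in>S x. \<Sum>l\<in>S y - {k}. block_colourings L (\<alpha>(k := 0, l := 0)))"
      by (simp only: block_colourings.simps S_def)
    also have "\<dots> = (\<Sum>k\<in>S x. \<Sum>l\<in>S y. if k = l then 0 else block_colourings L (\<alpha>(k := 0, l := 0)))"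
      by (intro sum.cong refl sum.mono_neutral_cong_left) (auto simp: fin)
    finally show ?thesis .
  qed
  show ?thesis
    unfolding * by (subst sum.swap) (auto intro!: sum.cong simp: fun_upd_twist)
qed

lemma block_colourings_insort: "finite {k. \<alpha> k \<noteq> 0} \<Longrightarrow> block_colourings (insort x L) \<alpha> = block_colourings (x # L) \<alpha>"
proof (induction L arbitrary: \<alpha>)
  case (Cons y L)
  have "finite {l. (\<alpha>(k := 0)) l \<noteq> 0}" for k
    by (rule finite_subset[OF _ Cons.prems]) auto
  then have "block_colourings (y # insort x L) \<alpha> = block_colourings (y # x # L) \<alpha>"
    unfolding block_colourings.simps(2)[of y] by (intro sum.cong refl Cons.IH)
  with block_colourings_swap[OF Cons.prems] show ?case by (simp del: block_colourings.simps)
qed simp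

lemma block_colourings_sort: "finite {k. \<alpha> k \<noteq> 0} \<Longrightarrow> block_colourings (sort L) \<alpha> = block_colourings L \<alpha>"
proof (induction L arbitrary: \<alpha>)
  case (Cons y L)
  have "finite {l. (\<alpha>(k := 0)) l \<noteq> 0}" for k
    by (rule finite_subset[OF _ Cons.prems]) auto
  then have "block_colourings (y # sort L) \<alpha> = block_colourings (y # L) \<alpha>"
    unfolding block_colourings.simps(2) by (intro sum.cong refl Cons.IH)
  with block_colourings_insort[OF Cons.prems] show ?case by (simp del: block_colourings.simps)
qed simp

text \<open>This is the expansion of the chromatic symmetric function in augmented monomial
  symmetric functions, truncated to at most \<open>k\<close> parts;
  \<open>block_colourings L \<alpha>\<close> is the coefficient of the monomial \<alpha> in the
  function indexed by \<open>L\<close>. Sorting lets stable partitions of equal type merge into one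
  term.\<close>

definition stable_types :: "('v \<Rightarrow> 'v \<Rightarrow> bool) \<Rightarrow> nat \<Rightarrow> 'v list \<Rightarrow> (nat list \<times> int) list" where
  "stable_types E k vs =
     lin_ext (\<lambda>\<pi>. [sort (map length \<pi>)]) (map (\<lambda>\<pi>. (\<pi>, 1)) (stable_partitions E k vs))"

lemma chrom_coeff_stable_types:
  assumes "distinct vs" "symp E" "irreflp E" "finite {k. \<alpha> k \<noteq> 0}" "card {k. \<alpha> k \<noteq> 0} \<le> K"
  shows "int (chrom_coeff (set vs) E \<alpha>) = lin_eval (\<lambda>L. int (block_colourings L \<alpha>)) (stable_types E K vs)"
proof -
  have "int (\<Sum>\<pi>\<leftarrow>xs. block_colourings (map length \<pi>) \<alpha>) = lin_eval (\<lambda>\<pi>. int (block_colourings (map length \<pi>) \<alpha>)) (map (\<lambda>\<pi>. (\<pi>, 1)) xs)"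
    for xs :: "'a list list list"
    by (induction xs) (simp_all add: lin_eval_def)
  then show ?thesis
    unfolding chrom_coeff_stable_partitions[OF assms] stable_types_def lin_eval_lin_ext
    by (simp add: block_colourings_sort[OF assms(4)])
qed

section \<open>Checking Schur positivity\<close>

fun agree :: "nat \<Rightarrow> (nat list \<times> int) list \<Rightarrow> (nat list \<times> int) list \<Rightarrow> bool" where
  "agree d G F = (if d = 0
     then lin_eval (\<lambda>L. if L = [] then 1 else 0) G = lin_eval (\<lambda>\<nu>. if sum_list \<nu> = 0 then 1 else 0) F
     else list_all (\<lambda>a. agree (d - a) (lin_ext (removals a) G) (lin_ext (strips a) F)) [1..<Suc d])"

declare agree.simps [simp del]

lemma block_colourings_zero: "block_colourings L (\<lambda>_. 0) = (if L = [] then 1 else 0)"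
  by (cases L) simp_all

lemma agree_correct:
  assumes "agree d G F" "finite {k. \<alpha> k \<noteq> 0}" "(\<Sum>k | \<alpha> k \<noteq> 0. \<alpha> k) = d"
  shows "lin_eval (\<lambda>L. int (block_colourings L \<alpha>)) G = lin_eval (\<lambda>lam. int (kostka lam \<alpha>)) F"
  using assms
proof (induction d arbitrary: G F \<alpha> rule: less_induct)
  case (less d)
  show ?case
  proof (cases "d = 0")
    case True
    have "\<alpha> = (\<lambda>_. 0)"
    proof (rule ccontr)
      assume "\<alpha> \<noteq> (\<lambda>_. 0)"
      then obtain k where "\<alpha> k \<noteq> 0" by auto
      with less.prems(2,3) True show False by simp
    qed
    moreover have "lin_eval (\<lambda>L. if L = [] then 1 else 0) G =
        lin_eval (\<lambda>\<nu>. if sum_list \<nu> = 0 then 1 else 0) F"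
      using less.prems(1) True by (simp only: agree.simps[of 0] simp_thms if_True)
    ultimately show ?thesis
      by (simp only: block_colourings_zero kostka_zero if_distrib[of int] of_nat_1 of_nat_0)
  next
    case False
    let ?S = "{k. \<alpha> k \<noteq> 0}"
    \<comment> \<open>With \<open>N\<close> the largest colour that occurs, both recursions apply:
      no colour above \<open>N\<close> is used, and the class of \<open>N\<close> is
      nonempty.\<close>
    define N where "N = Max ?S"
    have "?S \<noteq> {}" using False less.prems(3) by (metis sum.empty)
    then have N: "\<alpha> N \<noteq> 0" using Max_in[OF less.prems(2)] by (simp add: N_def)
    have top: "\<forall>k>N. \<alpha> k = 0"
      using Max_ge[OF less.prems(2)] unfolding N_def by (metis (mono_tags) leD mem_Collect_eq)
    let ?\<beta> = "\<alpha>(N := 0)"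
    have supp: "{k. ?\<beta> k \<noteq> 0} = ?S - {N}" by auto
    then have fin: "finite {k. ?\<beta> k \<noteq> 0}" using less.prems(2) by simp
    have "(\<Sum>k | ?\<beta> k \<noteq> 0. ?\<beta> k) = (\<Sum>k\<in>?S - {N}. \<alpha> k)"
      unfolding supp by (intro sum.cong) auto
    moreover have "d = \<alpha> N + (\<Sum>k\<in>?S - {N}. \<alpha> k)"
      using sum.remove[OF less.prems(2), of N \<alpha>] N less.prems(3) by simp
    ultimately have sum: "(\<Sum>k | ?\<beta> k \<noteq> 0. ?\<beta> k) = d - \<alpha> N" and le: "\<alpha> N \<le> d" by simp_all
    have "agree (d - \<alpha> N) (lin_ext (removals (\<alpha> N)) G) (lin_ext (strips (\<alpha> N)) F)"
      using less.prems(1)[unfolded agree.simps[of d]] False N le by (simp add: list_all_iff del: upt_Suc)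
    moreover have "d - \<alpha> N < d" using N False by simp
    ultimately have "lin_eval (\<lambda>L. int (block_colourings L ?\<beta>)) (lin_ext (removals (\<alpha> N)) G) =
        lin_eval (\<lambda>lam. int (kostka lam ?\<beta>)) (lin_ext (strips (\<alpha> N)) F)"
      using less.IH[OF _ _ fin sum] by blast
    then show ?thesis
      unfolding lin_eval_lin_ext block_colourings_removals[OF N less.prems(2)] kostka_strips[OF top]
      by (simp only: int_sum_list)
  qed
qed

lemma finite_partitions: "finite {lam. is_partition lam d}"
proof (rule finite_subset)
  show "{lam. is_partition lam d} \<subseteq> {xs. set xs \<subseteq> {..d} \<and> length xs \<le> d}"
  proof
    fix lam assume "lam \<in> {lam. is_partition lam d}"
    then have lam: "0 \<notin> set lam" "sum_list lam = d" by (auto simp: is_partition_def)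
    have "length lam \<le> sum_list lam" using lam(1) by (induction lam) auto
    moreover have "x \<le> sum_list lam" if "x \<in> set lam" for x using that by (simp add: member_le_sum_list)
    ultimately show "lam \<in> {xs. set xs \<subseteq> {..d} \<and> length xs \<le> d}" using lam(2) by auto
  qed
  show "finite {xs. set xs \<subseteq> {..d} \<and> length xs \<le> d}" by (rule finite_lists_length_le) simp
qed

text \<open>An infinite set has cardinality 0, so finiteness has to be shown: any one colouring
  determines the finite set of colours that all others with the same \<alpha> use.\<close>

lemma chrom_coeff_nonzero_iff:
  assumes "finite V"
  shows "chrom_coeff V E \<alpha> \<noteq> 0 \<longleftrightarrow> (\<exists>\<kappa>. (\<forall>v. v \<notin> V \<longrightarrow> \<kappa> v = 0) \<and>
      (\<forall>u\<in>V. \<forall>v\<in>V. E u v \<longrightarrow> \<kappa> u \<noteq> \<kappa> v) \<and> (\<forall>k. card {v \<in> V. \<kappa> v = k} = \<alpha> k))"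
proof -
  define S where "S = {\<kappa>. (\<forall>v. v \<notin> V \<longrightarrow> \<kappa> v = 0) \<and>
      (\<forall>u\<in>V. \<forall>v\<in>V. E u v \<longrightarrow> \<kappa> u \<noteq> \<kappa> v) \<and> (\<forall>k. card {v \<in> V. \<kappa> v = k} = \<alpha> k)}"
  have "finite S"
  proof (cases "S = {}")
    case False
    then obtain \<kappa> where "\<forall>k. card {v \<in> V. \<kappa> v = k} = \<alpha> k" unfolding S_def by blast
    from fibre_support[OF assms this] assms have "finite {k. \<alpha> k \<noteq> 0}" by simp
    from finite_colourings[OF assms this] show ?thesis
      by (rule finite_subset[rotated]) (unfold S_def, blast)
  qed simp
  moreover have "chrom_coeff V E \<alpha> = card S" unfolding chrom_coeff_def S_def ..
  ultimately have "chrom_coeff V E \<alpha> \<noteq> 0 \<longleftrightarrow> S \<noteq> {}" by simp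
  then show ?thesis unfolding S_def by blast
qed

lemma chrom_coeff_nonzeroD:
  assumes "chrom_coeff V E \<alpha> \<noteq> 0" "finite V"
  shows "finite {k. \<alpha> k \<noteq> 0}" "(\<Sum>k | \<alpha> k \<noteq> 0. \<alpha> k) = card V"
proof -
  from assms(1) obtain \<kappa> where "(\<forall>v. v \<notin> V \<longrightarrow> \<kappa> v = 0) \<and>
      (\<forall>u\<in>V. \<forall>v\<in>V. E u v \<longrightarrow> \<kappa> u \<noteq> \<kappa> v) \<and> (\<forall>k. card {v \<in> V. \<kappa> v = k} = \<alpha> k)"
    unfolding chrom_coeff_nonzero_iff[OF assms(2)] ..
  then have size: "\<forall>k. card {v \<in> V. \<kappa> v = k} = \<alpha> k" by (elim conjE)
  from fibre_support[OF assms(2) size] fibre_sum[OF assms(2) size] assms(2)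
  show "finite {k. \<alpha> k \<noteq> 0}" "(\<Sum>k | \<alpha> k \<noteq> 0. \<alpha> k) = card V" by simp_all
qed

text \<open>\<open>F\<close> is a proposed Schur expansion, confirmed by \<open>agree\<close>. With
  \<open>length vs\<close> as the bound on the number of blocks no stable partition is lost.\<close>

lemma schur_positiveI:
  assumes "distinct vs" "symp E" "irreflp E"
    and agree: "agree (length vs) (stable_types E (length vs) vs) F"
    and F: "list_all (\<lambda>(lam, c). 0 \<le> c \<and> is_partition lam (length vs)) F"
  shows "schur_positive (set vs) E"
proof -
  let ?d = "length vs"
  let ?P = "{lam. is_partition lam ?d}"
  define c where "c lam = lin_eval (\<lambda>l. of_bool (l = lam)) F" for lam
  have d: "card (set vs) = ?d" using assms(1) by (rule distinct_card)
  have "0 \<le> c lam" for lam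
    unfolding c_def lin_eval_def using F by (intro sum_list_nonneg) (auto simp: list_all_iff)
  moreover have "int (chrom_coeff (set vs) E \<alpha>) = (\<Sum>lam\<in>?P. c lam * int (kostka lam \<alpha>))" for \<alpha>
  proof -
    have "(\<Sum>lam\<in>?P. c lam * int (kostka lam \<alpha>)) = lin_eval (\<lambda>lam. int (kostka lam \<alpha>)) F"
      using F unfolding c_def lin_eval_def
    proof (induction F)
      case (Cons p F)
      obtain l a where p: "p = (l, a)" by force
      have "l \<in> ?P" using Cons.prems p by simp
      then have "(\<Sum>lam\<in>?P. a * of_bool (l = lam) * int (kostka lam \<alpha>)) = a * int (kostka l \<alpha>)"
        using finite_partitions[of ?d] by (subst sum.remove[of _ l]) (auto intro!: sum.neutral)
      with Cons show ?case by (simp add: p distrib_right sum.distrib)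
    qed simp
    also have "\<dots> = int (chrom_coeff (set vs) E \<alpha>)"
    \<comment> \<open>\<open>agree\<close> covers the finitely supported \<alpha> of degree
      \<open>?d\<close>; for all others both sides are zero.\<close>
    proof (cases "finite {k. \<alpha> k \<noteq> 0} \<and> (\<Sum>k | \<alpha> k \<noteq> 0. \<alpha> k) = ?d")
      case True
      then have "card {k. \<alpha> k \<noteq> 0} \<le> ?d"
        using sum_mono[of "{k. \<alpha> k \<noteq> 0}" "\<lambda>_. 1" \<alpha>] by (simp add: Suc_le_eq)
      with True show ?thesis
        using agree_correct[OF agree] chrom_coeff_stable_types[OF assms(1-3)] by simp
    next
      case False
      have k0: "kostka lam \<alpha> = 0" if "(lam, a) \<in> set F" for lam a
      proof (rule ccontr)
        assume "kostka lam \<alpha> \<noteq> 0"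
        note * = kostka_nonzeroD[OF this]
        have "is_partition lam ?d" using F that by (auto simp: list_all_iff)
        then have "sum_list lam = ?d" by (simp add: is_partition_def)
        with * False show False by metis
      qed
      have "lin_eval (\<lambda>lam. int (kostka lam \<alpha>)) F = lin_eval (\<lambda>_. 0) F"
        by (intro lin_eval_cong) (simp only: k0 of_nat_0)
      moreover have "chrom_coeff (set vs) E \<alpha> = 0"
      proof (rule ccontr)
        assume "chrom_coeff (set vs) E \<alpha> \<noteq> 0"
        from chrom_coeff_nonzeroD[OF this] False d show False by simp
      qed
      ultimately show ?thesis by (simp add: lin_eval_def case_prod_unfold)
    qed
    finally show ?thesis by simp
  qed
  ultimately show ?thesis unfolding schur_positive_def d by blast
qed

text \<open>The list gives the class sizes in decreasing order of the colours.\<close>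
fun content :: "nat list \<Rightarrow> nat \<Rightarrow> nat" where
  "content [] = (\<lambda>_. 0)"
| "content (a # l) = (content l)(length l := a)"

text \<open>With \<open>strips\<close> or \<open>removals\<close> for \<open>f\<close> this extracts
  a single coefficient; the head of the list belongs to the largest colour and is peeled
  first.\<close>

fun peel :: "(nat \<Rightarrow> 'a \<Rightarrow> 'a list) \<Rightarrow> nat list \<Rightarrow> ('a \<times> int) list \<Rightarrow> ('a \<times> int) list" where
  "peel f [] F = F"
| "peel f (a # l) F = peel f l (lin_ext (f a) F)"

lemma content_beyond: "length l \<le> k \<Longrightarrow> content l k = 0"
  by (induction l) auto

lemma content_support: "{k. content l k \<noteq> 0} \<subseteq> {..<length l}"
  using content_beyond by (metis (mono_tags) lessThan_iff linorder_not_less mem_Collect_eq subsetI)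

lemma content_upd: "(content (a # l))(length l := 0) = content l"
  using content_beyond[of l "length l"] by (auto simp: fun_eq_iff)

lemma kostka_content:
  "lin_eval (\<lambda>lam. int (kostka lam (content l))) F =
   lin_eval (\<lambda>lam. if sum_list lam = 0 then 1 else 0) (peel strips l F)"
proof (induction l arbitrary: F)
  case Nil
  show ?case by (simp only: content.simps peel.simps kostka_zero if_distrib[of int] of_nat_1 of_nat_0)
next
  case (Cons a l)
  have "\<forall>k>length l. content (a # l) k = 0" by (simp add: content_beyond)
  from kostka_strips[OF this]
  have "kostka lam (content (a # l)) = (\<Sum>\<nu>\<leftarrow>strips a lam. kostka \<nu> (content l))" for lam
    unfolding content_upd unfolding content.simps fun_upd_same .
  then show ?case
    unfolding peel.simps Cons.IH[symmetric] lin_eval_lin_ext by (simp only: int_sum_list)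
qed

lemma block_colourings_content:
  "0 \<notin> set l \<Longrightarrow> lin_eval (\<lambda>L. int (block_colourings L (content l))) G =
   lin_eval (\<lambda>L. if L = [] then 1 else 0) (peel removals l G)"
proof (induction l arbitrary: G)
  case Nil
  show ?case by (simp only: content.simps peel.simps block_colourings_zero if_distrib[of int] of_nat_1 of_nat_0)
next
  case (Cons a l)
  have "finite {k. content (a # l) k \<noteq> 0}"
    by (rule finite_subset[OF content_support]) simp
  moreover have a: "content (a # l) (length l) = a" by simp
  moreover have "content (a # l) (length l) \<noteq> 0" unfolding a using Cons.prems by auto
  ultimately have "block_colourings L (content (a # l)) = (\<Sum>L'\<leftarrow>removals a L. block_colourings L' (content l))" for L
    using block_colourings_removals[of "content (a # l)" "length l" L] unfolding content_upd a by blast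
  then have "lin_eval (\<lambda>L. int (block_colourings L (content (a # l)))) G =
      lin_eval (\<lambda>L. int (block_colourings L (content l))) (lin_ext (removals a) G)"
    unfolding lin_eval_lin_ext by (simp only: int_sum_list)
  with Cons show ?case by (simp del: content.simps)
qed

section \<open>Refutation by linear functionals and by balancing\<close>

fun bounded_partitions :: "nat \<Rightarrow> nat \<Rightarrow> nat list list" where
  "bounded_partitions k d = (if d = 0 then [[]]
     else concat (map (\<lambda>x. map ((#) x) (bounded_partitions x (d - x))) [1..<Suc (min k d)]))"

declare bounded_partitions.simps [simp del]

lemma bounded_partitions_complete:
  "is_partition lam d \<Longrightarrow> \<forall>x\<in>set lam. x \<le> k \<Longrightarrow> lam \<in> set (bounded_partitions k d)"
proof (induction lam arbitrary: k d)
  case Nil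
  then show ?case by (simp add: is_partition_def bounded_partitions.simps)
next
  case (Cons x lam)
  from Cons.prems have x: "0 < x" "x \<le> k" "x \<le> d" and lam: "is_partition lam (d - x)" "\<forall>y\<in>set lam. y \<le> x"
    by (auto simp: is_partition_def sorted_append)
  from Cons.IH[OF lam] x have "\<exists>y\<in>set [1..<Suc (min k d)]. x # lam \<in> (#) y ` set (bounded_partitions y (d - y))"
    by (intro bexI[of _ x]) auto
  with x show ?case by (subst bounded_partitions.simps) (simp del: upt_Suc)
qed

text \<open>The pairs in \<open>W\<close> define a linear functional on monomial coefficients.
  Nonnegative on each Schur function of degree \<open>d\<close>, it is nonnegative on every Schur
  positive function, so a negative value is a certificate.\<close>

lemma not_schur_positiveI:
  assumes "card V = d" "finite V"
    and pos: "list_all (\<lambda>lam. 0 \<le> (\<Sum>(l, w)\<leftarrow>W. w * int (kostka lam (content l)))) (bounded_partitions d d)"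
    and neg: "(\<Sum>(l, w)\<leftarrow>W. w * int (chrom_coeff V E (content l))) < 0"
  shows "\<not> schur_positive V E"
proof
  assume "schur_positive V E"
  then obtain c where c: "\<And>lam. 0 \<le> c lam"
    "\<And>\<alpha>. int (chrom_coeff V E \<alpha>) = (\<Sum>lam | is_partition lam d. c lam * int (kostka lam \<alpha>))"
    unfolding schur_positive_def assms(1) by auto
  have "(\<Sum>(l, w)\<leftarrow>W. w * int (chrom_coeff V E (content l))) =
      (\<Sum>(l, w)\<leftarrow>W. \<Sum>lam | is_partition lam d. c lam * (w * int (kostka lam (content l))))"
    unfolding c(2) sum_distrib_left by (simp add: mult.left_commute)
  also have "\<dots> = (\<Sum>lam | is_partition lam d. c lam * (\<Sum>(l, w)\<leftarrow>W. w * int (kostka lam (content l))))"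
    by (induction W) (auto simp: sum.distrib distrib_left)
  also have "\<dots> \<ge> 0"
  proof (intro sum_nonneg mult_nonneg_nonneg c(1))
    fix lam assume "lam \<in> {lam. is_partition lam d}"
    then have "lam \<in> set (bounded_partitions d d)"
      by (intro bounded_partitions_complete) (auto simp: is_partition_def intro: member_le_sum_list)
    with pos show "0 \<le> (\<Sum>(l, w)\<leftarrow>W. w * int (kostka lam (content l)))" by (simp add: list_all_iff)
  qed
  finally show False using neg by simp
qed

text \<open>Some Schur function in the expansion contributes to \<alpha>, and by
  \<open>kostka_shift_adjacent\<close> it contributes to the shifted vector too. As all coefficients
  are nonnegative, nothing cancels this contribution.\<close>

lemma schur_positive_shift:
  assumes "schur_positive V E" "chrom_coeff V E \<alpha> \<noteq> 0" "\<alpha> (Suc i) < \<alpha> i"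
  shows "chrom_coeff V E (\<alpha>(i := \<alpha> i - 1, Suc i := \<alpha> (Suc i) + 1)) \<noteq> 0"
proof -
  let ?\<beta> = "\<alpha>(i := \<alpha> i - 1, Suc i := \<alpha> (Suc i) + 1)"
  let ?P = "{lam. is_partition lam (card V)}"
  obtain c where c: "\<And>lam. 0 \<le> c lam"
    "\<And>\<alpha>. int (chrom_coeff V E \<alpha>) = (\<Sum>lam\<in>?P. c lam * int (kostka lam \<alpha>))"
    using assms(1) unfolding schur_positive_def by auto
  have "(\<Sum>lam\<in>?P. c lam * int (kostka lam \<alpha>)) \<noteq> 0" using assms(2) c(2)[of \<alpha>] by simp
  then obtain lam where lam: "lam \<in> ?P" "c lam \<noteq> 0" "kostka lam \<alpha> \<noteq> 0"
    by (metis (no_types, lifting) mult_eq_0_iff of_nat_0 sum.neutral)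
  have "0 < c lam * int (kostka lam ?\<beta>)"
    using c(1)[of lam] lam(2) kostka_shift_adjacent[OF assms(3) lam(3)] by simp
  also have "\<dots> \<le> int (chrom_coeff V E ?\<beta>)"
    unfolding c(2) using finite_partitions lam(1) c(1)
    by (intro member_le_sum) auto
  finally show ?thesis by simp
qed

section \<open>Fans\<close>

definition fan_list :: "nat \<Rightarrow> nat \<Rightarrow> (nat + nat) list" where
  "fan_list m n = map Inl [0..<m] @ map Inr [0..<n]"

lemma set_fan_list: "set (fan_list m n) = fan_V m n"
  by (auto simp: fan_list_def fan_V_def)

lemma distinct_fan_list: "distinct (fan_list m n)"
  by (auto simp: fan_list_def distinct_map)

lemma length_fan_list: "length (fan_list m n) = m + n"
  by (simp add: fan_list_def)

lemma card_fan_V: "card (fan_V m n) = m + n"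
  unfolding set_fan_list[symmetric] length_fan_list[symmetric] using distinct_fan_list by (rule distinct_card)

lemma finite_fan_V [simp]: "finite (fan_V m n)"
  by (simp add: fan_V_def)

lemma symp_fan_E: "symp fan_E"
proof (rule sympI)
  fix u v assume "fan_E u v" then show "fan_E v u" by (cases u; cases v) auto
qed

lemma irreflp_fan_E: "irreflp fan_E"
proof (rule irreflpI)
  fix u show "\<not> fan_E u u" by (cases u) auto
qed

lemma fan_schur_positiveI:
  assumes "agree (m + n) (stable_types fan_E (m + n) (fan_list m n)) F"
    "list_all (\<lambda>(lam, c). 0 \<le> c \<and> is_partition lam (m + n)) F"
  shows "schur_positive (fan_V m n) fan_E"
  using schur_positiveI[OF distinct_fan_list symp_fan_E irreflp_fan_E, of m n F] assms
  by (simp add: length_fan_list set_fan_list)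

text \<open>All premises can be evaluated. Contents of length at most \<open>K\<close> involve only
  stable partitions into at most \<open>K\<close> blocks, which keeps the enumeration small.\<close>

lemma fan_not_schur_positiveI:
  assumes "list_all (\<lambda>(l, w). 0 \<notin> set l \<and> length l \<le> K) W"
    "list_all (\<lambda>lam. 0 \<le> (\<Sum>(l, w)\<leftarrow>W. w *
       lin_eval (\<lambda>\<nu>. if sum_list \<nu> = 0 then 1 else 0) (peel strips l [(lam, 1)])))
       (bounded_partitions (m + n) (m + n))"
    "(\<Sum>(l, w)\<leftarrow>W. w * lin_eval (\<lambda>L. if L = [] then 1 else 0)
       (peel removals l (stable_types fan_E K (fan_list m n)))) < 0"
  shows "\<not> schur_positive (fan_V m n) fan_E"
proof (rule not_schur_positiveI[OF card_fan_V finite_fan_V, where W = W])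
  have "lin_eval (\<lambda>\<nu>. if sum_list \<nu> = 0 then 1 else 0) (peel strips l [(lam, 1)]) =
      int (kostka lam (content l))" for l lam
    unfolding kostka_content[symmetric] by (simp add: lin_eval_def)
  with assms(2) show "list_all (\<lambda>lam. 0 \<le> (\<Sum>(l, w)\<leftarrow>W. w * int (kostka lam (content l))))
      (bounded_partitions (m + n) (m + n))" by (simp only:)
  have "lin_eval (\<lambda>L. if L = [] then 1 else 0) (peel removals l (stable_types fan_E K (fan_list m n))) =
      int (chrom_coeff (fan_V m n) fan_E (content l))" if "(l, w) \<in> set W" for l w
  proof -
    from assms(1) that have l: "0 \<notin> set l" "length l \<le> K" by (auto simp: list_all_iff)
    have "finite {k. content l k \<noteq> 0}" by (rule finite_subset[OF content_support]) simp
    moreover have "card {k. content l k \<noteq> 0} \<le> K"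
      using card_mono[OF _ content_support, of l] l(2) by simp
    ultimately show ?thesis
      using chrom_coeff_stable_types[OF distinct_fan_list symp_fan_E irreflp_fan_E]
      unfolding block_colourings_content[OF l(1), symmetric] set_fan_list by metis
  qed
  then have "(\<Sum>(l, w)\<leftarrow>W. w * lin_eval (\<lambda>L. if L = [] then 1 else 0)
       (peel removals l (stable_types fan_E K (fan_list m n)))) =
    (\<Sum>(l, w)\<leftarrow>W. w * int (chrom_coeff (fan_V m n) fan_E (content l)))"
    by (intro arg_cong[where f = sum_list] map_cong refl) auto
  with assms(3) show "(\<Sum>(l, w)\<leftarrow>W. w * int (chrom_coeff (fan_V m n) fan_E (content l))) < 0" by simp
qed

section \<open>Colour class sizes of fans\<close>

text \<open>The path vertices are numbered from 0, so the even ones form the larger class, and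
  \<open>(n + 1) div 2\<close> is half of \<open>n\<close> rounded up.\<close>

lemma card_even_below: "card {i. i < n \<and> even i} = (n + 1) div 2"
proof (induction n)
  case (Suc n)
  have "{i. i < Suc n \<and> even i} = (if even n then insert n {i. i < n \<and> even i} else {i. i < n \<and> even i})"
    by (auto simp: less_Suc_eq)
  with Suc show ?case by simp
qed simp

lemma card_odd_below: "card {i. i < n \<and> odd i} = n div 2"
proof (induction n)
  case (Suc n)
  have "{i. i < Suc n \<and> odd i} = (if odd n then insert n {i. i < n \<and> odd i} else {i. i < n \<and> odd i})"
    by (auto simp: less_Suc_eq)
  with Suc show ?case by (cases "odd n") auto
qed simp

lemma card_fan_class:
  "card {v \<in> fan_V m n. \<kappa> v = k} = card {i. i < m \<and> \<kappa> (Inl i) = k} + card {i. i < n \<and> \<kappa> (Inr i) = k}"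
proof -
  have "{v \<in> fan_V m n. \<kappa> v = k} = Inl ` {i. i < m \<and> \<kappa> (Inl i) = k} \<union> Inr ` {i. i < n \<and> \<kappa> (Inr i) = k}"
    by (auto simp: fan_V_def)
  then show ?thesis
    by (subst card_Un_disjoint[symmetric, of "Inl ` {i. i < m \<and> \<kappa> (Inl i) = k}" "Inr ` {i. i < n \<and> \<kappa> (Inr i) = k}", simplified card_image[OF inj_on_subset[OF inj_Inl subset_UNIV]] card_image[OF inj_on_subset[OF inj_Inr subset_UNIV]]]) auto
qed

text \<open>The edgeless part gets colour \<open>a\<close>, the path alternates between \<open>p\<close> and \<open>q\<close> except on \<open>R\<close>.\<close>
lemma fan_colouring_exists:
  assumes R: "R \<subseteq> {..<n}" "\<And>i. i \<in> R \<Longrightarrow> Suc i \<notin> R"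
    and distinct: "distinct [a, p, q, r]"
    and \<alpha>: "\<And>k. \<alpha> k = (if k = a then m else if k = p then (n + 1) div 2 - card {i \<in> R. even i}
      else if k = q then n div 2 - card {i \<in> R. odd i} else if k = r then card R else 0)"
  shows "chrom_coeff (fan_V m n) fan_E \<alpha> \<noteq> 0"
proof -
  define \<kappa> where "\<kappa> v = (if v \<notin> fan_V m n then 0 else case v of Inl _ \<Rightarrow> a
    | Inr i \<Rightarrow> if i \<in> R then r else if even i then p else q)" for v
  have kL: "\<kappa> (Inl i) = a" if "i < m" for i using that by (simp add: \<kappa>_def fan_V_def)
  have kR: "\<kappa> (Inr i) = (if i \<in> R then r else if even i then p else q)" if "i < n" for i
    using that by (simp add: \<kappa>_def fan_V_def)
  have d: "a \<noteq> p" "a \<noteq> q" "a \<noteq> r" "p \<noteq> q" "p \<noteq> r" "q \<noteq> r" using distinct by auto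
  have cross: "\<kappa> (Inl i) \<noteq> \<kappa> (Inr j)" if "i < m" "j < n" for i j
    unfolding kL[OF that(1)] kR[OF that(2)] using d by simp
  \<comment> \<open>\<open>R\<close> has no two consecutive vertices, so colour \<open>r\<close>
    never meets itself, and off \<open>R\<close> neighbours have different parities.\<close>
  have path: "\<kappa> (Inr i) \<noteq> \<kappa> (Inr (Suc i))" if "Suc i < n" for i
  proof -
    from that have "i < n" by simp
    show ?thesis unfolding kR[OF that] kR[OF \<open>i < n\<close>] using R(2)[of i] d by simp
  qed
  have "\<forall>v. v \<notin> fan_V m n \<longrightarrow> \<kappa> v = 0" by (simp add: \<kappa>_def)
  moreover have "\<forall>u\<in>fan_V m n. \<forall>v\<in>fan_V m n. fan_E u v \<longrightarrow> \<kappa> u \<noteq> \<kappa> v"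
  proof (intro ballI impI)
    fix u v assume uv: "u \<in> fan_V m n" "v \<in> fan_V m n" "fan_E u v"
    then consider i j where "u = Inl i" "v = Inr j" | i j where "u = Inr i" "v = Inl j"
      | i where "u = Inr i" "v = Inr (Suc i)" | i where "u = Inr (Suc i)" "v = Inr i"
      by (cases u; cases v) auto
    then show "\<kappa> u \<noteq> \<kappa> v"
    proof cases
      case (1 i j)
      with uv cross[of i j] show ?thesis by (auto simp: fan_V_def)
    next
      case (2 i j)
      with uv cross[of j i] show ?thesis by (auto simp: fan_V_def)
    next
      case (3 i)
      with uv path[of i] show ?thesis by (auto simp: fan_V_def)
    next
      case (4 i)
      with uv path[of i] show ?thesis by (auto simp: fan_V_def)
    qed
  qed
  moreover have "card {v \<in> fan_V m n. \<kappa> v = k} = \<alpha> k" for k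
  proof -
    have finR: "finite R" using finite_subset[OF R(1)] by simp
    have L: "{i. i < m \<and> \<kappa> (Inl i) = k} = (if k = a then {..<m} else {})" using kL by auto
    have "\<kappa> (Inr i) = k \<longleftrightarrow> (if k = p then even i \<and> i \<notin> R
        else if k = q then odd i \<and> i \<notin> R else k = r \<and> i \<in> R)" if "i < n" for i
      unfolding kR[OF that] using d(4-6) by simp (auto split: if_splits)
    then have "{i. i < n \<and> \<kappa> (Inr i) = k} = {i. i < n \<and> (if k = p then even i \<and> i \<notin> R
        else if k = q then odd i \<and> i \<notin> R else k = r \<and> i \<in> R)}"
      by (intro Collect_cong conj_cong refl)
    also have "\<dots> = (if k = p then {i. i < n \<and> even i} - {i \<in> R. even i}
        else if k = q then {i. i < n \<and> odd i} - {i \<in> R. odd i} else if k = r then R else {})"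
      using R(1) by auto
    finally have P: "{i. i < n \<and> \<kappa> (Inr i) = k} = (if k = p then {i. i < n \<and> even i} - {i \<in> R. even i}
        else if k = q then {i. i < n \<and> odd i} - {i \<in> R. odd i} else if k = r then R else {})" .
    have E: "card ({i. i < n \<and> even i} - {i \<in> R. even i}) = (n + 1) div 2 - card {i \<in> R. even i}"
      using R(1) finR by (subst card_Diff_subset) (auto simp: card_even_below)
    have O: "card ({i. i < n \<and> odd i} - {i \<in> R. odd i}) = n div 2 - card {i \<in> R. odd i}"
      using R(1) finR by (subst card_Diff_subset) (auto simp: card_odd_below)
    show ?thesis unfolding card_fan_class \<alpha> L P using d by (simp add: E O)
  qed
  then have "\<forall>k. card {v \<in> fan_V m n. \<kappa> v = k} = \<alpha> k" ..
  ultimately show ?thesis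
    unfolding chrom_coeff_nonzero_iff[OF finite_fan_V] by (intro exI[of _ \<kappa>] conjI)
qed

text \<open>\<open>A\<close> holds the colours of the edgeless part and \<open>B\<close> those of
  the path; they are disjoint because all edges between the two parts are present. A single colour
  on the edgeless part makes a class of size \<open>m\<close>, and two colours on the path must
  alternate.\<close>

lemma fan_class_sizes:
  assumes "chrom_coeff (fan_V m n) fan_E \<alpha> \<noteq> 0" "0 < m" "2 \<le> n"
  obtains A B where "{k. \<alpha> k \<noteq> 0} = A \<union> B" "A \<inter> B = {}" "finite A" "finite B" "1 \<le> card A" "2 \<le> card B"
    "card A = 1 \<longrightarrow> (\<exists>x. \<alpha> x = m)"
    "card B = 2 \<longrightarrow> (\<exists>p q. p \<noteq> q \<and> \<alpha> p = (n + 1) div 2 \<and> \<alpha> q = n div 2)"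
proof -
  obtain \<kappa> where proper: "\<forall>u\<in>fan_V m n. \<forall>v\<in>fan_V m n. fan_E u v \<longrightarrow> \<kappa> u \<noteq> \<kappa> v"
    and size: "\<forall>k. card {v \<in> fan_V m n. \<kappa> v = k} = \<alpha> k"
  proof -
    from assms(1) obtain \<kappa> where "(\<forall>v. v \<notin> fan_V m n \<longrightarrow> \<kappa> v = 0) \<and>
      (\<forall>u\<in>fan_V m n. \<forall>v\<in>fan_V m n. fan_E u v \<longrightarrow> \<kappa> u \<noteq> \<kappa> v) \<and>
      (\<forall>k. card {v \<in> fan_V m n. \<kappa> v = k} = \<alpha> k)"
      unfolding chrom_coeff_nonzero_iff[OF finite_fan_V] ..
    then show thesis using that[of \<kappa>] by (elim conjE)
  qed
  define f g where "f i = \<kappa> (Inl i)" and "g i = \<kappa> (Inr i)" for i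
  have fg: "f i \<noteq> g j" if "i < m" "j < n" for i j
    using that proper[rule_format, of "Inl i" "Inr j"] by (simp add: f_def g_def fan_V_def)
  have gg: "g i \<noteq> g (Suc i)" if "Suc i < n" for i
    using that proper[rule_format, of "Inr i" "Inr (Suc i)"] by (simp add: g_def fan_V_def)
  have \<alpha>: "\<alpha> k = card {i. i < m \<and> f i = k} + card {i. i < n \<and> g i = k}" for k
    using size card_fan_class[of m n \<kappa> k] by (simp add: f_def g_def)
  let ?A = "f ` {..<m}" and ?B = "g ` {..<n}"
  show thesis
  proof (rule that[of ?A ?B])
    show "finite ?A" "finite ?B" by simp_all
    have "\<kappa> ` fan_V m n = ?A \<union> ?B" by (auto simp: fan_V_def f_def g_def)
    with fibre_support[OF finite_fan_V size] show "{k. \<alpha> k \<noteq> 0} = ?A \<union> ?B" by simp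
    show "?A \<inter> ?B = {}" using fg by auto
    show "1 \<le> card ?A" using assms(2) by (auto simp: Suc_le_eq card_gt_0_iff)
    have two: "{g 0, g 1} \<subseteq> ?B" "g 0 \<noteq> g 1" using assms(3) gg[of 0] by auto
    then have c2: "card {g 0, g 1} = 2" by simp
    with card_mono[OF _ two(1)] show "2 \<le> card ?B" by simp
    show "card ?A = 1 \<longrightarrow> (\<exists>x. \<alpha> x = m)"
    proof
      assume "card ?A = 1"
      then obtain x where x: "?A = {x}" by (rule card_1_singletonE)
      have "{i. i < m \<and> f i = x} = {..<m}" using x by auto
      moreover have "x \<in> ?A" using x by simp
      then have "{i. i < n \<and> g i = x} = {}" using fg by force
      ultimately have "\<alpha> x = m" unfolding \<alpha> by simp
      then show "\<exists>x. \<alpha> x = m" ..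
    qed
    show "card ?B = 2 \<longrightarrow> (\<exists>p q. p \<noteq> q \<and> \<alpha> p = (n + 1) div 2 \<and> \<alpha> q = n div 2)"
    proof
      assume two': "card ?B = 2"
      have B: "?B = {g 0, g 1}" using card_subset_eq[OF _ two(1)] c2 two' by simp
      have alt: "g i = (if even i then g 0 else g 1)" if "i < n" for i
        using that
      proof (induction i)
        case (Suc i)
        then have "g (Suc i) \<in> {g 0, g 1}" unfolding B[symmetric] by blast
        with Suc gg[of i] show ?case by (auto split: if_splits)
      qed simp
      have none: "{i. i < m \<and> f i = g j} = {}" if "j < n" for j using fg that by auto
      have par: "g i = g 0 \<longleftrightarrow> even i" "g i = g 1 \<longleftrightarrow> odd i" if "i < n" for i
        unfolding alt[OF that] using two(2) by auto
      have e: "{i. i < n \<and> g i = g 0} = {i. i < n \<and> even i}"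
        by (intro Collect_cong conj_cong refl par)
      have o: "{i. i < n \<and> g i = g 1} = {i. i < n \<and> odd i}"
        by (intro Collect_cong conj_cong refl par)
      have "0 < n" "1 < n" using assms(3) by simp_all
      then have "\<alpha> (g 0) = (n + 1) div 2" "\<alpha> (g 1) = n div 2"
        unfolding \<alpha> e o card_even_below card_odd_below by (simp_all only: none card.empty add_0)
      with two(2) show "\<exists>p q. p \<noteq> q \<and> \<alpha> p = (n + 1) div 2 \<and> \<alpha> q = n div 2"
        by (intro exI[of _ "g 0"] exI[of _ "g 1"] conjI)
    qed
  qed
qed

section \<open>Fans excluded by balancing two classes\<close>

definition sizes :: "nat \<Rightarrow> nat \<Rightarrow> nat \<Rightarrow> nat \<Rightarrow> nat \<Rightarrow> nat" where
  "sizes w x y z k = (if k = 0 then w else if k = 1 then x else if k = 2 then y else if k = 3 then z else 0)"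

lemma sizes_shift:
  assumes "schur_positive V E" "chrom_coeff V E (sizes w x y z) \<noteq> 0" "x < w"
  shows "chrom_coeff V E (sizes (w - 1) (x + 1) y z) \<noteq> 0"
proof -
  have "(sizes w x y z)(0 := sizes w x y z 0 - 1, Suc 0 := sizes w x y z (Suc 0) + 1) =
      sizes (w - 1) (x + 1) y z"
    by (auto simp: sizes_def fun_eq_iff)
  then show ?thesis
    using schur_positive_shift[OF assms(1,2), of 0] assms(3) by (simp add: sizes_def)
qed

text \<open>Of three colours the path needs at least two and the edgeless part at least one, so both
  extreme cases of \<open>fan_class_sizes\<close> occur at once.\<close>

lemma fan_sizes_three:
  assumes "chrom_coeff (fan_V m n) fan_E (sizes w x y 0) \<noteq> 0" "0 < m" "2 \<le> n" "0 < w" "0 < x" "0 < y"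
  shows "m \<in> {w, x, y}"
    "\<exists>p q. p \<noteq> q \<and> sizes w x y 0 p = (n + 1) div 2 \<and> sizes w x y 0 q = n div 2"
proof -
  obtain A B where *:
    "{k. sizes w x y 0 k \<noteq> 0} = A \<union> B" "A \<inter> B = {}" "finite A" "finite B" "1 \<le> card A" "2 \<le> card B"
    "card A = 1 \<longrightarrow> (\<exists>k. sizes w x y 0 k = m)"
    "card B = 2 \<longrightarrow> (\<exists>p q. p \<noteq> q \<and> sizes w x y 0 p = (n + 1) div 2 \<and> sizes w x y 0 q = n div 2)"
    by (rule fan_class_sizes[OF assms(1-3)])
  have supp: "{k. sizes w x y 0 k \<noteq> 0} = {0, 1, 2}" using assms(4-6) by (auto simp: sizes_def)
  have "card A + card B = card (A \<union> B)" using *(2-4) by (simp add: card_Un_disjoint)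
  also have "\<dots> = 3" unfolding *(1)[symmetric] supp by simp
  finally have "card A + card B = 3" .
  with *(5,6) have "card A = 1" "card B = 2" by simp_all
  with *(7,8) assms(2) show "m \<in> {w, x, y}"
    "\<exists>p q. p \<noteq> q \<and> sizes w x y 0 p = (n + 1) div 2 \<and> sizes w x y 0 q = n div 2"
    by (auto simp: sizes_def split: if_splits)
qed

text \<open>Four colours split as 1 + 3 or 2 + 2 between the edgeless part and the path, so only one
  of the two restrictions is certain.\<close>

lemma fan_sizes_four:
  assumes "chrom_coeff (fan_V m n) fan_E (sizes w x y z) \<noteq> 0" "0 < m" "2 \<le> n"
    "0 < w" "0 < x" "0 < y" "0 < z"
  shows "m \<in> {w, x, y, z} \<or>
    (\<exists>p q. p \<noteq> q \<and> sizes w x y z p = (n + 1) div 2 \<and> sizes w x y z q = n div 2)"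
proof -
  obtain A B where *:
    "{k. sizes w x y z k \<noteq> 0} = A \<union> B" "A \<inter> B = {}" "finite A" "finite B" "1 \<le> card A" "2 \<le> card B"
    "card A = 1 \<longrightarrow> (\<exists>k. sizes w x y z k = m)"
    "card B = 2 \<longrightarrow> (\<exists>p q. p \<noteq> q \<and> sizes w x y z p = (n + 1) div 2 \<and> sizes w x y z q = n div 2)"
    by (rule fan_class_sizes[OF assms(1-3)])
  have supp: "{k. sizes w x y z k \<noteq> 0} = {0, 1, 2, 3}" using assms(4-7) by (auto simp: sizes_def)
  have "card A + card B = card (A \<union> B)" using *(2-4) by (simp add: card_Un_disjoint)
  also have "\<dots> = 4" unfolding *(1)[symmetric] supp by simp
  finally have "card A + card B = 4" .
  with *(5,6) consider "card A = 1" | "card B = 2" by linarith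
  then show ?thesis
  proof cases
    case 1
    with *(7) assms(2) show ?thesis by (auto simp: sizes_def split: if_splits)
  qed (use *(8) in blast)
qed

lemma fan_not_schur_positive_three:
  assumes "0 < m" "2 \<le> n" "n div 2 + 2 \<le> m \<or> m + 2 \<le> (n + 1) div 2"
  shows "\<not> schur_positive (fan_V m n) fan_E"
proof
  assume pos: "schur_positive (fan_V m n) fan_E"
  from assms(3) show False
  proof
    assume m: "n div 2 + 2 \<le> m"
    have "chrom_coeff (fan_V m n) fan_E (sizes m (n div 2) ((n + 1) div 2) 0) \<noteq> 0"
      by (rule fan_colouring_exists[of "{}" n 0 2 1 3]) (auto simp: sizes_def)
    \<comment> \<open>The balanced sizes \<open>m - 1\<close>, \<open>n div 2 + 1\<close> and
      \<open>(n + 1) div 2\<close> are all less than \<open>m\<close>.\<close>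
    from fan_sizes_three(1)[OF sizes_shift[OF pos this]] m assms(1,2) show False by auto
  next
    assume m: "m + 2 \<le> (n + 1) div 2"
    have "chrom_coeff (fan_V m n) fan_E (sizes ((n + 1) div 2) m (n div 2) 0) \<noteq> 0"
      by (rule fan_colouring_exists[of "{}" n 1 0 2 3]) (auto simp: sizes_def)
    \<comment> \<open>After the move only the class of size \<open>n div 2\<close> can still have
      size \<open>(n + 1) div 2\<close>, and then no second class of that size is left.\<close>
    from fan_sizes_three(2)[OF sizes_shift[OF pos this]] m assms(1,2)
    obtain p q where pq: "p \<noteq> q" "sizes ((n + 1) div 2 - 1) (m + 1) (n div 2) 0 p = (n + 1) div 2"
      "sizes ((n + 1) div 2 - 1) (m + 1) (n div 2) 0 q = n div 2" by auto
    from pq(2) m assms(1) have "p = 2" "n div 2 = (n + 1) div 2"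
      by (auto simp: sizes_def split: if_splits)
    with pq(1,3) m assms(1) show False by (auto simp: sizes_def split: if_splits)
  qed
qed

text \<open>For \<open>n = 1\<close> the path takes a single colour, so
  \<open>fan_class_sizes\<close> does not apply. The centre of the star is always alone in its
  class, but balancing \<open>m\<close> and 1 gives \<open>m - 1\<close> and 2, both greater than
  1.\<close>

lemma star_not_schur_positive:
  assumes "3 \<le> m"
  shows "\<not> schur_positive (fan_V m 1) fan_E"
proof
  assume pos: "schur_positive (fan_V m 1) fan_E"
  have "chrom_coeff (fan_V m 1) fan_E (sizes m 1 0 0) \<noteq> 0"
    by (rule fan_colouring_exists[of "{}" 1 0 1 2 3]) (auto simp: sizes_def)
  from sizes_shift[OF pos this] assms
  obtain \<kappa> where proper: "\<forall>u\<in>fan_V m 1. \<forall>v\<in>fan_V m 1. fan_E u v \<longrightarrow> \<kappa> u \<noteq> \<kappa> v"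
    and size: "\<forall>k. card {v \<in> fan_V m 1. \<kappa> v = k} = sizes (m - 1) 2 0 0 k"
    unfolding chrom_coeff_nonzero_iff[OF finite_fan_V] by (auto simp: numeral_2_eq_2)
  have "{v \<in> fan_V m 1. \<kappa> v = \<kappa> (Inr 0)} = {Inr 0}"
    using proper by (force simp: fan_V_def)
  with size have "sizes (m - 1) 2 0 0 (\<kappa> (Inr 0)) = 1" by (metis card_1_singleton_iff One_nat_def)
  with assms show False by (auto simp: sizes_def split: if_splits)
qed

text \<open>The last two hypotheses make the balanced vector violate both alternatives of
  \<open>fan_sizes_four\<close>. The form \<open>p = q\<close> tolerates a single class matching
  both halves of the path when these are equal.\<close>

lemma fan_not_schur_positive_four:
  assumes "0 < m" "2 \<le> n" "chrom_coeff (fan_V m n) fan_E (sizes w x y z) \<noteq> 0"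
    "x < w" "1 < w" "0 < y" "0 < z" "m \<notin> {w - 1, x + 1, y, z}"
    "\<And>p q. sizes (w - 1) (x + 1) y z p = (n + 1) div 2 \<Longrightarrow>
       sizes (w - 1) (x + 1) y z q = n div 2 \<Longrightarrow> p = q"
  shows "\<not> schur_positive (fan_V m n) fan_E"
proof
  assume pos: "schur_positive (fan_V m n) fan_E"
  have "0 < w - 1" "0 < x + 1" using assms(5) by simp_all
  from fan_sizes_four[OF sizes_shift[OF pos assms(3,4)] assms(1,2) this assms(6,7)] assms(8)
  obtain p q where "p \<noteq> q" "sizes (w - 1) (x + 1) y z p = (n + 1) div 2"
    "sizes (w - 1) (x + 1) y z q = n div 2" by blast
  with assms(9) show False by metis
qed

text \<open>\<open>e\<close> and \<open>b\<close> count the even and odd path vertices given the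
  fourth colour. Passing them and the halves of \<open>n\<close> as equations lets each application
  work with explicit values.\<close>

lemma fan_sizes_exist:
  assumes "card {i \<in> R. even i} = e" "card {i \<in> R. odd i} = b" "(n + 1) div 2 = c" "n div 2 = c'"
    "R \<subseteq> {..<n}" "\<And>i. i \<in> R \<Longrightarrow> Suc i \<notin> R" "distinct [a, p, q, r]"
    "\<And>k. \<alpha> k = (if k = a then m else if k = p then c - e else if k = q then c' - b
      else if k = r then e + b else 0)"
  shows "chrom_coeff (fan_V m n) fan_E \<alpha> \<noteq> 0"
proof (rule fan_colouring_exists[OF assms(5-7)])
  have "finite R" using finite_subset[OF assms(5)] by simp
  then have "card R = card {i \<in> R. even i} + card {i \<in> R. odd i}"
    by (subst card_Un_disjoint[symmetric]) (auto intro!: arg_cong[where f = card])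
  with assms(1,2) have "card R = e + b" by simp
  with assms(1-4,8) show "\<alpha> k = (if k = a then m else if k = p then (n + 1) div 2 - card {i \<in> R. even i}
      else if k = q then n div 2 - card {i \<in> R. odd i} else if k = r then card R else 0)" for k
    by simp
qed

text \<open>In each case two or three path vertices get a fourth colour so that a path class shrinks
  to \<open>m - 2\<close> or \<open>m - 3\<close>, and a unit is moved to it from the edgeless class
  of size \<open>m\<close>. The lower bounds on \<open>m\<close> keep the fourth class away from the
  critical sizes.\<close>

lemma fan_not_schur_positive_near_double:
  assumes "3 \<le> m"
  shows "\<not> schur_positive (fan_V m (2 * m - 1)) fan_E"
    and "\<not> schur_positive (fan_V m (2 * m + 1)) fan_E"
    and "4 \<le> m \<Longrightarrow> \<not> schur_positive (fan_V m (2 * m)) fan_E"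
    and "4 \<le> m \<Longrightarrow> \<not> schur_positive (fan_V m (2 * m + 2)) fan_E"
    and "5 \<le> m \<Longrightarrow> \<not> schur_positive (fan_V m (2 * m - 2)) fan_E"
proof -
  \<comment> \<open>Balanced sizes: \<open>m - 1\<close> three times and 2. Size \<open>m\<close>,
    also that of the larger half of the path, is missing.\<close>
  show "\<not> schur_positive (fan_V m (2 * m - 1)) fan_E"
  proof (rule fan_not_schur_positive_four)
    have "{i \<in> {0, 2 :: nat}. even i} = {0, 2}" "{i \<in> {0, 2 :: nat}. odd i} = {}"
      by (auto intro: odd_pos)
    then have R: "card {i \<in> {0, 2 :: nat}. even i} = 2" "card {i \<in> {0, 2 :: nat}. odd i} = 0"
      by simp_all
    have n: "(2 * m - 1 + 1) div 2 = m" "(2 * m - 1) div 2 = m - 1" using assms by auto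
    show "chrom_coeff (fan_V m (2 * m - 1)) fan_E (sizes m (m - 2) (m - 1) 2) \<noteq> 0"
      by (rule fan_sizes_exist[OF R n, of 0 1 2 3]) (use assms in \<open>auto simp: sizes_def\<close>)
    show "p = q" if "sizes (m - 1) (m - 2 + 1) (m - 1) 2 p = (2 * m - 1 + 1) div 2" for p q
      using that assms unfolding n by (auto simp: sizes_def split: if_splits)
  qed (use assms in auto)
  \<comment> \<open>Balanced sizes: \<open>m - 1\<close> twice, \<open>m + 1\<close> and 2. Size
    \<open>m\<close>, also that of the smaller half of the path, is missing.\<close>
  show "\<not> schur_positive (fan_V m (2 * m + 1)) fan_E"
  proof (rule fan_not_schur_positive_four)
    have "{i \<in> {1, 3 :: nat}. even i} = {}" "{i \<in> {1, 3 :: nat}. odd i} = {1, 3}"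
      by (auto intro: odd_pos)
    then have R: "card {i \<in> {1, 3 :: nat}. even i} = 0" "card {i \<in> {1, 3 :: nat}. odd i} = 2"
      by simp_all
    have n: "(2 * m + 1 + 1) div 2 = m + 1" "(2 * m + 1) div 2 = m" by auto
    show "chrom_coeff (fan_V m (2 * m + 1)) fan_E (sizes m (m - 2) (m + 1) 2) \<noteq> 0"
      by (rule fan_sizes_exist[OF R n, of 0 2 1 3]) (use assms in \<open>auto simp: sizes_def\<close>)
    show "p = q" if "sizes (m - 1) (m - 2 + 1) (m + 1) 2 q = (2 * m + 1) div 2" for p q
      using that assms unfolding n by (auto simp: sizes_def split: if_splits)
  qed (use assms in auto)
  \<comment> \<open>Balanced sizes: \<open>m - 1\<close> three times and 3, with \<open>m\<close>
    missing. For \<open>m = 3\<close> the fourth class would have size \<open>m\<close>.\<close>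
  show "\<not> schur_positive (fan_V m (2 * m)) fan_E" if m: "4 \<le> m"
  proof (rule fan_not_schur_positive_four)
    have "{i \<in> {0, 2, 2 * m - 1}. even i} = {0, 2}" "{i \<in> {0, 2, 2 * m - 1}. odd i} = {2 * m - 1}"
      using m by (auto intro: odd_pos)
    then have R: "card {i \<in> {0, 2, 2 * m - 1}. even i} = 2" "card {i \<in> {0, 2, 2 * m - 1}. odd i} = 1"
      by simp_all
    have n: "(2 * m + 1) div 2 = m" "2 * m div 2 = m" by auto
    show "chrom_coeff (fan_V m (2 * m)) fan_E (sizes m (m - 2) (m - 1) 3) \<noteq> 0"
      by (rule fan_sizes_exist[OF R n, of 0 1 2 3]) (use m in \<open>auto simp: sizes_def\<close>)
    show "p = q" if "sizes (m - 1) (m - 2 + 1) (m - 1) 3 p = (2 * m + 1) div 2" for p q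
      using that m unfolding n by (auto simp: sizes_def split: if_splits)
  qed (use m in auto)
  \<comment> \<open>Balanced sizes: \<open>m - 1\<close> twice, \<open>m + 1\<close> and 3. The two
    halves of the path need \<open>m + 1\<close> twice; for \<open>m = 3\<close> the fourth class
    would have size \<open>m\<close>.\<close>
  show "\<not> schur_positive (fan_V m (2 * m + 2)) fan_E" if m: "4 \<le> m"
  proof (rule fan_not_schur_positive_four)
    have "{i \<in> {1, 3, 5 :: nat}. even i} = {}" "{i \<in> {1, 3, 5 :: nat}. odd i} = {1, 3, 5}"
      by (auto intro: odd_pos)
    then have R: "card {i \<in> {1, 3, 5 :: nat}. even i} = 0" "card {i \<in> {1, 3, 5 :: nat}. odd i} = 3"
      by simp_all
    have n: "(2 * m + 2 + 1) div 2 = m + 1" "(2 * m + 2) div 2 = m + 1" by auto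
    show "chrom_coeff (fan_V m (2 * m + 2)) fan_E (sizes m (m - 2) (m + 1) 3) \<noteq> 0"
      by (rule fan_sizes_exist[OF R n, of 0 2 1 3]) (use m in \<open>auto simp: sizes_def\<close>)
    show "p = q" if "sizes (m - 1) (m - 2 + 1) (m + 1) 3 p = (2 * m + 2 + 1) div 2"
      "sizes (m - 1) (m - 2 + 1) (m + 1) 3 q = (2 * m + 2) div 2" for p q
      using that m unfolding n by (auto simp: sizes_def split: if_splits)
  qed (use m in auto)
  \<comment> \<open>Balanced sizes: \<open>m - 1\<close>, \<open>m - 2\<close> twice and 3. The two
    halves of the path need \<open>m - 1\<close> twice, which happens for \<open>m = 4\<close>
    through the fourth class.\<close>
  show "\<not> schur_positive (fan_V m (2 * m - 2)) fan_E" if m: "5 \<le> m"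
  proof (rule fan_not_schur_positive_four)
    have "{i \<in> {0, 2, 2 * m - 3}. even i} = {0, 2}" "{i \<in> {0, 2, 2 * m - 3}. odd i} = {2 * m - 3}"
      using m by (auto intro: odd_pos)
    then have R: "card {i \<in> {0, 2, 2 * m - 3}. even i} = 2" "card {i \<in> {0, 2, 2 * m - 3}. odd i} = 1"
      by simp_all
    have n: "(2 * m - 2 + 1) div 2 = m - 1" "(2 * m - 2) div 2 = m - 1" using m by auto
    show "chrom_coeff (fan_V m (2 * m - 2)) fan_E (sizes m (m - 3) (m - 2) 3) \<noteq> 0"
      by (rule fan_sizes_exist[OF R n, of 0 1 2 3]) (use m in \<open>auto simp: sizes_def\<close>)
    show "p = q" if "sizes (m - 1) (m - 3 + 1) (m - 2) 3 p = (2 * m - 2 + 1) div 2"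
      "sizes (m - 1) (m - 3 + 1) (m - 2) 3 q = (2 * m - 2) div 2" for p q
      using that m unfolding n by (auto simp: sizes_def split: if_splits)
  qed (use m in auto)
qed

section \<open>The finitely many remaining fans\<close>

text \<open>Here and in the following positive cases \<open>F\<close> lists the complete Schur
  expansion, and both premises are settled by evaluation.\<close>

lemma fan_1_1_schur_positive: "schur_positive (fan_V 1 1) fan_E"
  by (rule fan_schur_positiveI[where F = "[
    ([1, 1], 2)]"]; code_simp)

lemma fan_1_2_schur_positive: "schur_positive (fan_V 1 2) fan_E"
  by (rule fan_schur_positiveI[where F = "[
    ([1, 1, 1], 6)]"]; code_simp)

lemma fan_1_3_schur_positive: "schur_positive (fan_V 1 3) fan_E"
  by (rule fan_schur_positiveI[where F = "[
    ([2, 1, 1], 2), ([1, 1, 1, 1], 18)]"]; code_simp)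

lemma fan_1_4_schur_positive: "schur_positive (fan_V 1 4) fan_E"
  by (rule fan_schur_positiveI[where F = "[
    ([2, 2, 1], 2), ([2, 1, 1, 1], 14), ([1, 1, 1, 1, 1], 54)]"]; code_simp)

lemma fan_2_1_schur_positive: "schur_positive (fan_V 2 1) fan_E"
  by (rule fan_schur_positiveI[where F = "[
    ([2, 1], 1), ([1, 1, 1], 4)]"]; code_simp)

lemma fan_2_2_schur_positive: "schur_positive (fan_V 2 2) fan_E"
  by (rule fan_schur_positiveI[where F = "[
    ([2, 1, 1], 2), ([1, 1, 1, 1], 18)]"]; code_simp)

lemma fan_2_3_schur_positive: "schur_positive (fan_V 2 3) fan_E"
  by (rule fan_schur_positiveI[where F = "[
    ([2, 2, 1], 2), ([2, 1, 1, 1], 8), ([1, 1, 1, 1, 1], 78)]"]; code_simp)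

lemma fan_2_4_schur_positive: "schur_positive (fan_V 2 4) fan_E"
  by (rule fan_schur_positiveI[where F = "[
    ([2, 2, 2], 6), ([2, 2, 1, 1], 10), ([2, 1, 1, 1, 1], 54), 
    ([1, 1, 1, 1, 1, 1], 330)]"]; code_simp)

lemma fan_2_5_schur_positive: "schur_positive (fan_V 2 5) fan_E"
  by (rule fan_schur_positiveI[where F = "[
    ([3, 2, 2], 2), ([3, 2, 1, 1], 2), ([3, 1, 1, 1, 1], 14), ([2, 2, 2, 1], 26), 
    ([2, 2, 1, 1, 1], 56), ([2, 1, 1, 1, 1, 1], 366), ([1, 1, 1, 1, 1, 1, 1], 1374)]"]; code_simp)

lemma fan_2_6_schur_positive: "schur_positive (fan_V 2 6) fan_E"
  by (rule fan_schur_positiveI[where F = "[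
    ([3, 3, 2], 2), ([3, 3, 1, 1], 2), ([3, 2, 2, 1], 14), ([3, 2, 1, 1, 1], 44), 
    ([3, 1, 1, 1, 1, 1], 212), ([2, 2, 2, 2], 68), ([2, 2, 2, 1, 1], 50), 
    ([2, 2, 1, 1, 1, 1], 410), ([2, 1, 1, 1, 1, 1, 1], 2238), 
    ([1, 1, 1, 1, 1, 1, 1, 1], 5658)]"]; code_simp)

lemma fan_3_4_schur_positive: "schur_positive (fan_V 3 4) fan_E"
  by (rule fan_schur_positiveI[where F = "[
    ([3, 2, 2], 2), ([3, 2, 1, 1], 4), ([3, 1, 1, 1, 1], 8), ([2, 2, 2, 1], 4), 
    ([2, 2, 1, 1, 1], 70), ([2, 1, 1, 1, 1, 1], 300), ([1, 1, 1, 1, 1, 1, 1], 1902)]"]; code_simp)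

text \<open>The weights for \<open>(3,6)\<close> come from the expansion of the coefficient of \<open>s\<^sub>3\<^sub>2\<^sub>2\<^sub>2\<close>, with the monomials that do
not occur in the chromatic symmetric function replaced by a single one.\<close>
lemma fan_3_6_not_schur_positive: "\<not> schur_positive (fan_V 3 6) fan_E"
  by (rule fan_not_schur_positiveI[where K = 4 and
        W = "[([3, 2, 2, 2], 1), ([3, 3, 2, 1], -2), ([3, 3, 3], 1), ([4, 3, 1, 1], 1)]"]; code_simp)

text \<open>Kostka numbers do not decrease when the content passes from (4,3,3,1) to the more
  balanced (4,3,2,2). The graph nevertheless has fewer colourings of the balanced type.\<close>

lemma fan_3_8_not_schur_positive: "\<not> schur_positive (fan_V 3 8) fan_E"
  by (rule fan_not_schur_positiveI[where K = 4 and
        W = "[([4, 3, 2, 2], 1), ([4, 3, 3, 1], -1)]"]; code_simp)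

text \<open>The same comparison of numbers rather than of mere occurrence: (3,3,2,2) is more
  balanced than (4,2,2,2), yet has fewer colourings.\<close>

lemma fan_4_6_not_schur_positive: "\<not> schur_positive (fan_V 4 6) fan_E"
  by (rule fan_not_schur_positiveI[where K = 4 and
        W = "[([3, 3, 2, 2], 1), ([4, 2, 2, 2], -1)]"]; code_simp)

section \<open>The classification\<close>

theorem theorem3p6:
  fixes m n :: nat
  assumes "m > 0" and "n > 0"
  shows "schur_positive (fan_V m n) fan_E \<longleftrightarrow>
    ((m = 1 \<and> n \<in> {1..4}) \<or> (m = 2 \<and> n \<in> {1..6}) \<or> (m = 3 \<and> n = 4))"
proof
  let ?listed = "(m = 1 \<and> n \<in> {1..4}) \<or> (m = 2 \<and> n \<in> {1..6}) \<or> (m = 3 \<and> n = 4)"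
  assume ?listed
  then have "(m, n) \<in> {(1, 1), (1, 2), (1, 3), (1, 4), (2, 1), (2, 2), (2, 3), (2, 4), (2, 5), (2, 6), (3, 4)}"
    by auto
  then show "schur_positive (fan_V m n) fan_E"
    using fan_1_1_schur_positive fan_1_2_schur_positive fan_1_3_schur_positive fan_1_4_schur_positive
      fan_2_1_schur_positive fan_2_2_schur_positive fan_2_3_schur_positive fan_2_4_schur_positive
      fan_2_5_schur_positive fan_2_6_schur_positive fan_3_4_schur_positive
    by (elim insertE emptyE) (simp_all only: prod.inject)
next
  assume pos: "schur_positive (fan_V m n) fan_E"
  show "(m = 1 \<and> n \<in> {1..4}) \<or> (m = 2 \<and> n \<in> {1..6}) \<or> (m = 3 \<and> n = 4)"
  proof (cases "n = 1")
    case True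
    with star_not_schur_positive[of m] pos have "m < 3" by (cases "3 \<le> m") auto
    with True assms(1) show ?thesis by auto
  next
    case False
    with assms(2) have n: "2 \<le> n" by simp
    with fan_not_schur_positive_three[OF assms(1) n] pos
    \<comment> \<open>These bounds say that \<open>n\<close> lies between \<open>2 * m - 2\<close>
      and \<open>2 * m + 2\<close>.\<close>
    have m: "m \<le> n div 2 + 1" "(n + 1) div 2 \<le> m + 1" by force+
    show ?thesis
    proof (cases "3 \<le> m")
      case m3: True
      from m n consider "n = 2 * m - 1" | "n = 2 * m + 1" | "n = 2 * m" | "n = 2 * m + 2" | "n = 2 * m - 2"
        by linarith
      then show ?thesis
      proof cases
        case 1
        with fan_not_schur_positive_near_double(1)[OF m3] pos show ?thesis by simp
      next
        case 2
        with fan_not_schur_positive_near_double(2)[OF m3] pos show ?thesis by simp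
      next
        case 3
        with fan_not_schur_positive_near_double(3)[OF m3] fan_3_6_not_schur_positive pos m3
        show ?thesis by (cases "m = 3") simp_all
      next
        case 4
        with fan_not_schur_positive_near_double(4)[OF m3] fan_3_8_not_schur_positive pos m3
        show ?thesis by (cases "m = 3") simp_all
      next
        case 5
        \<comment> \<open>For \<open>m = 3\<close> this is \<open>n = 4\<close>, the only positive
          fan with \<open>m\<close> at least 3.\<close>
        with fan_not_schur_positive_near_double(5)[OF m3] fan_4_6_not_schur_positive pos m3
        show ?thesis by (cases "m = 3"; cases "m = 4") simp_all
      qed
    next
      case False
      with assms(1) consider "m = 1" | "m = 2" by linarith
      \<comment> \<open>The bounds become \<open>n \<le> 4\<close> for \<open>m = 1\<close> and
        \<open>n \<le> 6\<close> for \<open>m = 2\<close>, so nothing outside the list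
        remains.\<close>
      then show ?thesis using m n by cases auto
    qed
  qed
qed

end
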